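(* Let $\mathcal H$ be a separable complex Hilbert space. Let $\mathbf J\in\mathcal B(\mathcal H)$ be skew-adjoint and $\mathbf R\in\mathcal B(\mathcal H)$ be self-adjoint with $\mathbf R\ge0$ and possibly $\dim\ker\mathbf R=\infty$. Consider the following conditions (for $m=\infty$, indices $j$ from $0$ to $m$ range over all of $\mathbb N_0$): (B1') There exists $m\in\mathbb N_0\cup\{\infty\}$ such that $\overline{\operatorname{span}}\big(\bigcup_{j=0}^m\operatorname{im}(\mathbf J^j\sqrt{\mathbf R})\big)=\mathcal H$. (B2') There exists $m\in\mathbb N_0\cup\{\infty\}$ such that $\bigcap_{j=0}^m\ker(\sqrt{\mathbf R}(\mathbf J^* )^j)=\{0\}$. (B3') There exists $m\in\mathbb N_0\cup\{\infty\}$ such that for all $x\in\mathcal H\setminus\{0\}$ there exists $j=j(x)\le m$ if $m$ is finite, or $j=j(x)\in\mathbb N_0$ if $m=\infty$, such that $\langle\mathbf J^j\mathbf R(\mathbf J^* )^jx,x\rangle>0$. (B4') If a closed subspace $V$ of $\ker\mathbf R$ is invariant under $\mathbf J$, then $V=\{0\}$. (B5') No eigenvector of $\mathbf J$ lies in the kernel of $\mathbf R$. Then the implications (B1') $\Leftrightarrow$ (B2') $\Leftrightarrow$ (B3') $\Leftrightarrow$ (B4') $\Rightarrow$ (B5') hold. The implication (B5') $\Rightarrow$ (B4') holds if and only if $\dim\ker\mathbf R<\infty$.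
   Context: $\mathcal B(\mathcal H)$ is the space of bounded linear operators on $\mathcal H$; $\overline{\operatorname{span}}$ is the closed linear span; $\sqrt{\mathbf R}$ is the unique nonnegative self-adjoint square root of $\mathbf R$. Skew-adjoint means $\mathbf J^*=-\mathbf J$. *)

theory Defs
  imports
    "HOL-Analysis.Analysis"
    "HOL-Library.Complex_Order"
    "HOL-Library.Extended_Nat"
begin

section \<open>Complex Hilbert spaces\<close>

text \<open>
  A complex inner product space is given on top of the library's real inner product
  spaces: the real inner product is the real part of the complex one, so that the norm is
  \<open>\<parallel>x\<parallel> = sqrt \<langle>x, x\<rangle>\<close>, and the library's topology, closure and boundedness are the usual ones.
  The complex inner product is linear in its first argument. Its positive definiteness
  follows from that of the real inner product and from conjugate symmetry.
\<close>

class complex_inner = real_inner +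
  fixes scaleC :: "complex \<Rightarrow> 'a \<Rightarrow> 'a" (infixr "*\<^sub>C" 75)
    and cinner :: "'a \<Rightarrow> 'a \<Rightarrow> complex"
  assumes scaleC_add_right: "c *\<^sub>C (x + y) = c *\<^sub>C x + c *\<^sub>C y"
    and scaleC_add_left: "(c + d) *\<^sub>C x = c *\<^sub>C x + d *\<^sub>C x"
    and scaleC_scaleC: "c *\<^sub>C (d *\<^sub>C x) = (c * d) *\<^sub>C x"
    and scaleR_scaleC: "r *\<^sub>R x = complex_of_real r *\<^sub>C x"
    and cinner_commute: "cinner x y = cnj (cinner y x)"
    and cinner_add_left: "cinner (x + y) z = cinner x z + cinner y z"
    and cinner_scaleC_left: "cinner (c *\<^sub>C x) y = c * cinner x y"
    and inner_cinner: "inner x y = Re (cinner x y)"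

class complex_hilbert_space = complex_inner + complete_space

instantiation complex :: complex_hilbert_space
begin

definition scaleC_complex :: "complex \<Rightarrow> complex \<Rightarrow> complex"
  where "scaleC_complex c x = c * x"

definition cinner_complex :: "complex \<Rightarrow> complex \<Rightarrow> complex"
  where "cinner_complex x y = x * cnj y"

instance
  by standard
    (auto simp: scaleC_complex_def cinner_complex_def inner_complex_def algebra_simps
      scaleR_conv_of_real)

end

global_interpretation complex_vector:
  vector_space "scaleC :: complex \<Rightarrow> 'a \<Rightarrow> 'a :: complex_inner"
  defines csubspace = complex_vector.subspace
    and cspan = complex_vector.span
proof unfold_locales
  show "1 *\<^sub>C x = x" for x :: 'a
    using scaleR_scaleC[of 1 x] by simp
qed (auto simp: scaleC_add_right scaleC_add_left scaleC_scaleC)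

definition cfinite_dimensional :: "'a :: complex_inner set \<Rightarrow> bool"
  where "cfinite_dimensional V \<longleftrightarrow> (\<exists>B. finite B \<and> cspan B = V)"


section \<open>Bounded operators\<close>

definition bounded_clinear :: "('a :: complex_inner \<Rightarrow> 'b :: complex_inner) \<Rightarrow> bool"
  where "bounded_clinear A \<longleftrightarrow> bounded_linear A \<and> (\<forall>c x. A (c *\<^sub>C x) = c *\<^sub>C A x)"

text \<open>
  The adjoint is unique whenever it exists, and it exists for bounded
  operators on a Hilbert space, the only ones to which it is applied.
\<close>

definition cadjoint :: "('a :: complex_inner \<Rightarrow> 'a) \<Rightarrow> 'a \<Rightarrow> 'a"
  where "cadjoint A = (THE B. \<forall>x y. cinner (A x) y = cinner x (B y))"

definition self_adjoint :: "('a :: complex_inner \<Rightarrow> 'a) \<Rightarrow> bool"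
  where "self_adjoint A \<longleftrightarrow> cadjoint A = A"

definition skew_adjoint :: "('a :: complex_inner \<Rightarrow> 'a) \<Rightarrow> bool"
  where "skew_adjoint A \<longleftrightarrow> cadjoint A = (\<lambda>x. - A x)"

text \<open>
  In the order on \<^typ>\<open>complex\<close>, \<open>0 \<le> z\<close> and \<open>0 < z\<close> include that \<open>z\<close> is real.
\<close>

definition nonneg_op :: "('a :: complex_inner \<Rightarrow> 'a) \<Rightarrow> bool"
  where "nonneg_op A \<longleftrightarrow> (\<forall>x. 0 \<le> cinner (A x) x)"

definition op_sqrt :: "('a :: complex_inner \<Rightarrow> 'a) \<Rightarrow> 'a \<Rightarrow> 'a"
  where "op_sqrt R = (THE S. bounded_clinear S \<and> self_adjoint S \<and> nonneg_op S \<and> S \<circ> S = R)"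

definition ker :: "('a :: complex_inner \<Rightarrow> 'b :: complex_inner) \<Rightarrow> 'a set"
  where "ker A = {x. A x = 0}"

definition is_eigenvector :: "('a :: complex_inner \<Rightarrow> 'a) \<Rightarrow> 'a \<Rightarrow> bool"
  where "is_eigenvector A x \<longleftrightarrow> x \<noteq> 0 \<and> (\<exists>\<mu>. A x = \<mu> *\<^sub>C x)"


section \<open>The conditions\<close>

definition B1 :: "('a :: complex_inner \<Rightarrow> 'a) \<Rightarrow> ('a \<Rightarrow> 'a) \<Rightarrow> bool"
  where "B1 J R \<longleftrightarrow>
    (\<exists>m::enat. closure (cspan (\<Union>j\<in>{j::nat. enat j \<le> m}. range ((J ^^ j) \<circ> op_sqrt R))) = UNIV)"

definition B2 :: "('a :: complex_inner \<Rightarrow> 'a) \<Rightarrow> ('a \<Rightarrow> 'a) \<Rightarrow> bool"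
  where "B2 J R \<longleftrightarrow>
    (\<exists>m::enat. (\<Inter>j\<in>{j::nat. enat j \<le> m}. ker (op_sqrt R \<circ> (cadjoint J ^^ j))) = {0})"

definition B3 :: "('a :: complex_inner \<Rightarrow> 'a) \<Rightarrow> ('a \<Rightarrow> 'a) \<Rightarrow> bool"
  where "B3 J R \<longleftrightarrow>
    (\<exists>m::enat. \<forall>x. x \<noteq> 0 \<longrightarrow>
      (\<exists>j::nat. enat j \<le> m \<and> 0 < cinner ((J ^^ j) (R ((cadjoint J ^^ j) x))) x))"

definition B4 :: "('a :: complex_inner \<Rightarrow> 'a) \<Rightarrow> ('a \<Rightarrow> 'a) \<Rightarrow> bool"
  where "B4 J R \<longleftrightarrow>
    (\<forall>V. csubspace V \<and> closed V \<and> V \<subseteq> ker R \<and> J ` V \<subseteq> V \<longrightarrow> V = {0})"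

definition B5 :: "('a :: complex_inner \<Rightarrow> 'a) \<Rightarrow> ('a \<Rightarrow> 'a) \<Rightarrow> bool"
  where "B5 J R \<longleftrightarrow> \<not> (\<exists>x. is_eigenvector J x \<and> x \<in> ker R)"

end

theory Submission
  imports Defs "HOL-Computational_Algebra.Fundamental_Theorem_Algebra"
begin

text \<open>
  Write \<open>S\<close> for the square root of \<open>R\<close>. All of \<open>B1\<close> to \<open>B4\<close> amount to the claim that no nonzero vector has its whole
  \<open>J\<close>-orbit inside \<open>ker R\<close>. A vector \<open>y\<close> is orthogonal to the range of \<open>J ^^ j \<circ> S\<close> iff
  \<open>S ((cadjoint J ^^ j) y) = 0\<close>, and a set spans a dense subspace iff only \<open>0\<close> is orthogonal to it;
  this is \<open>B1\<close> \<open>\<longleftrightarrow>\<close> \<open>B2\<close>. The number tested in \<open>B3\<close> is \<open>(norm (S ((cadjoint J ^^ j) x)))\<^sup>2\<close>; this is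
  \<open>B2\<close> \<open>\<longleftrightarrow>\<close> \<open>B3\<close>. In both cases the same bound \<open>m\<close> works on the two sides. Since \<open>cadjoint J = - J\<close> and
  \<open>ker S = ker R\<close>, the intersection in \<open>B2\<close> over all \<open>j\<close> is the largest closed \<open>J\<close>-invariant
  subspace of \<open>ker R\<close>, and an invariant subspace of \<open>ker R\<close> lies in the intersection for
  every \<open>m\<close>; this is \<open>B2\<close> \<open>\<longleftrightarrow>\<close> \<open>B4\<close>. Finally \<open>B4\<close> implies \<open>B5\<close> because the eigenvectors for one
  eigenvalue that lie in \<open>ker R\<close> form, together with \<open>0\<close>, a closed invariant subspace.
  
  If \<open>ker R\<close> is finite-dimensional, a nonzero invariant subspace of it contains an eigenvector
  of \<open>J\<close>, by the fundamental theorem of algebra (\<open>finite_dimensional_invariant_eigenvector\<close>), so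
  \<open>B5\<close> implies \<open>B4\<close>. If \<open>ker R\<close> is infinite-dimensional, separability gives an orthonormal
  sequence \<open>e\<^sub>0, e\<^sub>1, \<dots>\<close> in \<open>ker R\<close> to which no nonzero vector of \<open>ker R\<close> is orthogonal. For the shift
  \<open>U e\<^sub>n = e\<^sub>n\<^sub>+\<^sub>1\<close>, extended by \<open>0\<close> to the orthogonal complement of the sequence, the operator \<open>U - U\<^sup>*\<close>
  is skew-adjoint and leaves the nonzero subspace \<open>ker R\<close> invariant, so \<open>B4\<close>
  fails. An eigenvector has coordinates \<open>a\<^sub>n\<close> with \<open>a\<^sub>n\<^sub>+\<^sub>1 = a\<^sub>n\<^sub>-\<^sub>1 - \<mu> a\<^sub>n\<close>, for which
  \<open>\<bar>a\<^sub>n\<^sub>+\<^sub>1\<^sup>2 + \<mu> a\<^sub>n\<^sub>+\<^sub>1 a\<^sub>n - a\<^sub>n\<^sup>2\<bar>\<close> does not depend on \<open>n\<close>; coordinates tend to \<open>0\<close>, so this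
  number is \<open>0\<close> and all \<open>a\<^sub>n\<close> vanish. Hence no eigenvector lies in \<open>ker R\<close> and \<open>B5\<close> holds.
  
  Adjoints and square roots are developed on real Hilbert spaces and transferred to complex ones:
  the complex inner product is determined by its real part, and the square root of \<open>R\<close> commutes with
  every bounded operator that commutes with \<open>R\<close>, in particular with complex scalars.
\<close>

section \<open>Orthogonal projections and adjoints in real Hilbert spaces\<close>

text \<open>
  This makes the results on real Hilbert spaces below, and those on Banach spaces in the library,
  apply to complex Hilbert spaces.
\<close>

instance complex_hilbert_space \<subseteq> banach ..

text \<open>
  The parallelogram law makes any sequence in \<open>S\<close> whose distance to \<open>x\<close> tends to the infimum a
  Cauchy sequence. Its limit is a point of \<open>S\<close> nearest to \<open>x\<close>, and nearest points are
  orthogonal projections.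
\<close>

lemma orthogonal_projection_exists:
  fixes S :: "'a :: {real_inner, banach} set"
  assumes S: "subspace S" "closed S"
  shows "\<exists>p\<in>S. \<forall>y\<in>S. inner (x - p) y = 0"
proof -
  define d where "d = (INF y\<in>S. (norm (x - y))\<^sup>2)"
  have bdd: "bdd_below ((\<lambda>y. (norm (x - y))\<^sup>2) ` S)"
    by (rule bdd_belowI2[of _ 0]) simp
  have ne: "S \<noteq> {}" using S(1) subspace_0 by blast
  have d_le: "d \<le> (norm (x - y))\<^sup>2" if "y \<in> S" for y
    unfolding d_def using bdd that by (rule cINF_lower)
  have "\<exists>y\<in>S. (norm (x - y))\<^sup>2 < d + 1 / real (Suc n)" for n
    using cInf_lessD[of "(\<lambda>y. (norm (x - y))\<^sup>2) ` S" "d + 1 / real (Suc n)"] ne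
    unfolding d_def by auto
  then obtain q where q: "\<And>n. q n \<in> S" "\<And>n. (norm (x - q n))\<^sup>2 < d + 1 / real (Suc n)"
    by metis
  have close: "(norm (q m - q n))\<^sup>2 \<le> 2 / real (Suc m) + 2 / real (Suc n)" for m n
  proof -
    have mid: "(1/2) *\<^sub>R (q m + q n) \<in> S"
      using S(1) q(1) by (simp add: subspace_add subspace_scale)
    have "(norm (q m - q n))\<^sup>2 = 2 * (norm (x - q m))\<^sup>2 + 2 * (norm (x - q n))\<^sup>2
        - 4 * (norm (x - (1/2) *\<^sub>R (q m + q n)))\<^sup>2"
      unfolding power2_norm_eq_inner
      by (simp add: inner_diff_left inner_diff_right inner_add_left inner_add_right inner_commute algebra_simps)
    then show ?thesis
      using d_le[OF mid] q(2)[of m] q(2)[of n] by linarith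
  qed
  have "Cauchy q"
  proof (rule metric_CauchyI)
    fix e :: real assume e: "0 < e"
    then obtain N where N: "inverse (real (Suc N)) < e\<^sup>2 / 4"
      using reals_Archimedean[of "e\<^sup>2 / 4"] by auto
    have "dist (q m) (q n) < e" if "m \<ge> N" "n \<ge> N" for m n
    proof -
      have "1 / real (Suc m) \<le> 1 / real (Suc N)" "1 / real (Suc n) \<le> 1 / real (Suc N)"
        using that by (auto intro!: divide_left_mono)
      then have "(norm (q m - q n))\<^sup>2 < e\<^sup>2"
        using close[of m n] N by (simp add: inverse_eq_divide)
      then show ?thesis
        using e by (simp add: dist_norm power2_less_imp_less)
    qed
    then show "\<exists>M. \<forall>m\<ge>M. \<forall>n\<ge>M. dist (q m) (q n) < e" by blast
  qed
  then obtain p where p: "q \<longlonglongrightarrow> p"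
    using Cauchy_convergent_iff convergentD by blast
  have pS: "p \<in> S"
    using closed_sequentially[OF S(2) q(1) p] .
  have p_min: "(norm (x - p))\<^sup>2 \<le> d"
  proof (rule LIMSEQ_le)
    show "(\<lambda>n. (norm (x - q n))\<^sup>2) \<longlonglongrightarrow> (norm (x - p))\<^sup>2"
      by (intro tendsto_intros p)
    show "(\<lambda>n. d + 1 / real (Suc n)) \<longlonglongrightarrow> d"
      using tendsto_add[OF tendsto_const LIMSEQ_inverse_real_of_nat, of d]
      by (simp add: inverse_eq_divide)
  qed (use q(2) less_imp_le in blast)
  have "inner (x - p) y = 0" if y: "y \<in> S" for y
  proof (cases "y = 0")
    case False
    \<comment> \<open>this \<open>t\<close> minimises \<open>norm (x - p - t *\<^sub>R y)\<close>\<close>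
    define t where "t = inner (x - p) y / inner y y"
    have "p + t *\<^sub>R y \<in> S"
      using S(1) pS y by (simp add: subspace_add subspace_scale)
    then have "(norm (x - p))\<^sup>2 \<le> (norm (x - p - t *\<^sub>R y))\<^sup>2"
      using order_trans[OF p_min d_le[of "p + t *\<^sub>R y"]] by (simp only: diff_diff_eq)
    also have "\<dots> = (norm (x - p))\<^sup>2 - t * inner (x - p) y"
    proof -
      define u where "u = x - p"
      have "t * inner y y = inner u y" using False by (simp add: t_def u_def)
      then show ?thesis
        unfolding power2_norm_eq_inner u_def[symmetric]
        by (simp add: inner_diff_left inner_diff_right inner_commute algebra_simps)
    qed
    finally have "(inner (x - p) y)\<^sup>2 / inner y y \<le> 0"
      by (simp add: t_def power2_eq_square)
    then show ?thesis
      using False inner_ge_zero[of y] inner_eq_zero_iff[of y]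
      by (auto simp only: divide_le_0_iff zero_eq_power2 power2_less_eq_zero_iff)
  qed simp
  then show ?thesis using pS by blast
qed

text \<open>
  A vector orthogonal to the kernel of \<open>f\<close> represents \<open>f\<close> up to a scalar, because the kernel has
  codimension at most one.
\<close>

lemma Riesz_representation:
  fixes f :: "'a :: {real_inner, banach} \<Rightarrow> real"
  assumes "bounded_linear f"
  shows "\<exists>z. \<forall>x. f x = inner x z"
proof (cases "\<forall>x. f x = 0")
  case False
  interpret f: bounded_linear f by fact
  obtain x where x: "f x \<noteq> 0" using False by blast
  have "closed {x. f x = 0}"
    by (rule closed_Collect_eq) (auto intro: f.continuous_on)
  moreover have "subspace {x. f x = 0}"
    by (auto simp: subspace_def f.add f.scaleR f.zero)
  ultimately obtain p where p: "f p = 0" "\<And>y. f y = 0 \<Longrightarrow> inner (x - p) y = 0"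
    using orthogonal_projection_exists[of "{x. f x = 0}" x] by auto
  define u where "u = x - p"
  have fu: "f u \<noteq> 0" using x p(1) by (simp add: u_def f.diff)
  then have u: "inner u u \<noteq> 0" using f.zero by auto
  have "f y = inner y ((f u / inner u u) *\<^sub>R u)" for y
  proof -
    have "inner u (f u *\<^sub>R y - f y *\<^sub>R u) = 0"
      unfolding u_def by (rule p(2)) (simp add: f.diff f.scaleR)
    then show ?thesis using u
      by (simp add: inner_diff_right inner_commute field_simps)
  qed
  then show ?thesis by blast
qed (auto intro: exI[of _ 0])

lemma real_adjoint_exists:
  fixes A :: "'a :: {real_inner, banach} \<Rightarrow> 'b :: real_inner"
  assumes "bounded_linear A"
  shows "\<exists>B. \<forall>x y. inner (A x) y = inner x (B y)"
proof -
  have "\<exists>z. \<forall>x. inner (A x) y = inner x z" for y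
    by (rule Riesz_representation)
      (rule bounded_linear_compose[OF bounded_linear_inner_left assms])
  then show ?thesis by metis
qed

section \<open>Square roots of nonnegative symmetric operators\<close>

text \<open>
  Nonnegativity at the single point \<open>x - R x / K\<close> gives the bound. It has two uses: it turns
  \<open>inner (R x) x = 0\<close> into \<open>R x = 0\<close>, and it makes \<open>x \<mapsto> x - R x / K\<close> a contraction.
\<close>

lemma nonneg_symmetric_norm_le:
  fixes R :: "'a :: real_inner \<Rightarrow> 'a"
  assumes "linear R" and sym: "\<And>x y. inner (R x) y = inner x (R y)"
    and pos: "\<And>x. 0 \<le> inner (R x) x" and K: "0 < K" "\<And>x. norm (R x) \<le> K * norm x"
  shows "(norm (R x))\<^sup>2 \<le> K * inner (R x) x"
proof -
  interpret R: linear R by fact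
  define y where "y = R x"
  have "0 \<le> inner (R (x - (1/K) *\<^sub>R y)) (x - (1/K) *\<^sub>R y)" by (rule pos)
  also have "\<dots> = inner (R x) x - (2/K) * inner y y + (1/K)\<^sup>2 * inner (R y) y"
    using sym[of y x]
    by (simp add: R.diff R.scaleR inner_diff_left inner_diff_right y_def[symmetric] power2_eq_square
        inner_commute algebra_simps)
  also have "inner (R y) y \<le> K * (norm y)\<^sup>2"
    using norm_cauchy_schwarz[of "R y" y] mult_right_mono[OF K(2)[of y] norm_ge_zero[of y]]
    by (simp add: power2_eq_square)
  finally have "0 \<le> inner (R x) x - (2/K) * inner y y + (1/K)\<^sup>2 * (K * inner y y)"
    using K(1) by (simp add: mult_left_mono power2_norm_eq_inner)
  also have "\<dots> = inner (R x) x - inner y y / K"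
    using K(1) by (simp add: field_simps power2_eq_square)
  finally show ?thesis
    using K(1) by (simp add: y_def power2_norm_eq_inner field_simps)
qed

text \<open>
  The coefficients of the power series of \<open>sqrt (1 - t)\<close> at \<open>0\<close>.
\<close>

definition sqrt_coeff :: "nat \<Rightarrow> real"
  where "sqrt_coeff n = (- 1) ^ n * ((1/2) gchoose n)"

lemma sqrt_coeff_0 [simp]: "sqrt_coeff 0 = 1"
  by (simp add: sqrt_coeff_def)

text \<open>
  All coefficients but the first are nonpositive, and the partial sums are nonnegative. Hence the
  series converges absolutely at \<open>t = 1\<close>, which is what a contraction, as opposed to a strict
  contraction, requires. That the coefficients after the first have absolute sum at most \<open>1\<close> also
  gives nonnegativity of the square root.
\<close>

lemma sqrt_coeff_nonpos:
  assumes "0 < n"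
  shows "sqrt_coeff n \<le> 0"
proof -
  obtain k where n: "n = Suc k" using assms gr0_conv_Suc by blast
  have "sqrt_coeff n = (- (1/2)) * pochhammer (1/2) k / fact n"
    by (simp add: sqrt_coeff_def gbinomial_pochhammer n pochhammer_rec)
  also have "\<dots> \<le> 0"
    by (simp add: divide_nonpos_pos pochhammer_nonneg)
  finally show ?thesis .
qed

lemma sqrt_coeff_sum_nonneg: "0 \<le> (\<Sum>k\<le>n. sqrt_coeff k)"
proof -
  have "(\<Sum>k\<le>n. sqrt_coeff k) = (-1) ^ n * ((1/2 - 1) gchoose n)"
    using gbinomial_sum_lower_neg[of "1/2::real" n] by (simp add: sqrt_coeff_def mult.commute)
  also have "\<dots> = pochhammer (1/2) n / fact n"
    by (simp add: gbinomial_pochhammer)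
  finally show ?thesis by (simp add: pochhammer_nonneg)
qed

lemma sqrt_coeff_abs_sum_le: "(\<Sum>k\<le>n. \<bar>sqrt_coeff (Suc k)\<bar>) \<le> 1"
proof -
  have "(\<Sum>k\<le>n. \<bar>sqrt_coeff (Suc k)\<bar>) = 1 - (\<Sum>k\<le>Suc n. sqrt_coeff k)"
    by (subst sum.atMost_Suc_shift) (simp add: sqrt_coeff_nonpos sum_negf)
  then show ?thesis using sqrt_coeff_sum_nonneg[of "Suc n"] by linarith
qed

lemma summable_abs_sqrt_coeff: "summable (\<lambda>n. \<bar>sqrt_coeff n\<bar>)"
proof -
  have "summable (\<lambda>n. \<bar>sqrt_coeff (Suc n)\<bar>)"
  proof (rule summableI_nonneg_bounded)
    show "(\<Sum>k<n. \<bar>sqrt_coeff (Suc k)\<bar>) \<le> 1" for n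
      using sqrt_coeff_abs_sum_le[of "n - 1"] by (cases n) (auto simp: lessThan_Suc_atMost)
  qed simp
  then show ?thesis by (subst (asm) summable_Suc_iff)
qed

lemma suminf_abs_sqrt_coeff_le: "(\<Sum>n. \<bar>sqrt_coeff (Suc n)\<bar>) \<le> 1"
proof (rule suminf_le_const)
  show "summable (\<lambda>n. \<bar>sqrt_coeff (Suc n)\<bar>)"
    using summable_abs_sqrt_coeff by (subst summable_Suc_iff)
  show "(\<Sum>k<n. \<bar>sqrt_coeff (Suc k)\<bar>) \<le> 1" for n
    using sqrt_coeff_abs_sum_le[of "n - 1"] by (cases n) (auto simp: lessThan_Suc_atMost)
qed

text \<open>
  The formal identity \<open>sqrt (1 - t) * sqrt (1 - t) = 1 - t\<close>, an instance of Vandermonde's identity.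
\<close>

lemma sqrt_coeff_convolution:
  "(\<Sum>i\<le>n. sqrt_coeff i * sqrt_coeff (n - i)) = (if n = 0 then 1 else if n = 1 then - 1 else 0)"
proof -
  have "(\<Sum>i\<le>n. sqrt_coeff i * sqrt_coeff (n - i)) =
      (\<Sum>i\<le>n. (-1)^n * (((1/2) gchoose i) * ((1/2) gchoose (n - i))))"
    by (rule sum.cong)
      (auto simp: sqrt_coeff_def mult_ac simp flip: power_add)
  also have "\<dots> = (-1)^n * (1 gchoose n)"
    using gbinomial_Vandermonde[of "1/2::real" "1/2" n] by (simp add: sum_distrib_left [symmetric] atMost_atLeast0)
  also have "\<dots> = (if n = 0 then 1 else if n = 1 then - 1 else 0)"
    using binomial_gbinomial[of 1 n, where ?'a=real]
    by (cases n rule: nat.exhaust; cases "n = 1") (auto simp: binomial_eq_0)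
  finally show ?thesis .
qed


text \<open>
  For a contraction \<open>B\<close> the operator \<open>sqrt (1 - B)\<close> is given by its binomial series.
\<close>

context
  fixes B :: "'a :: {real_inner, banach} \<Rightarrow> 'a"
  assumes linB: "bounded_linear B" and contr: "\<And>x. norm (B x) \<le> norm x"
begin

lemma bounded_linear_funpow: "bounded_linear (B ^^ n)"
proof (induction n)
  case (Suc n)
  then show ?case
    using bounded_linear_compose[OF linB Suc] by (simp add: o_def)
qed (simp add: id_def)

lemma norm_funpow_le: "norm ((B ^^ n) x) \<le> norm x"
  by (induction n) (auto intro: order_trans[OF contr])

definition sqrt_series :: "'a \<Rightarrow> 'a"
  where "sqrt_series x = (\<Sum>n. sqrt_coeff n *\<^sub>R (B ^^ n) x)"

lemma norm_sqrt_series_term: "norm (sqrt_coeff n *\<^sub>R (B ^^ n) x) \<le> \<bar>sqrt_coeff n\<bar> * norm x"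
  by (simp add: mult_left_mono norm_funpow_le)

lemma summable_norm_sqrt_series: "summable (\<lambda>n. norm (sqrt_coeff n *\<^sub>R (B ^^ n) x))"
proof (rule summable_comparison_test')
  show "summable (\<lambda>n. \<bar>sqrt_coeff n\<bar> * norm x)"
    by (rule summable_mult2) (rule summable_abs_sqrt_coeff)
qed (use norm_sqrt_series_term in auto)

lemma sums_sqrt_series: "(\<lambda>n. sqrt_coeff n *\<^sub>R (B ^^ n) x) sums sqrt_series x"
  unfolding sqrt_series_def
  by (rule summable_sums) (rule summable_norm_cancel[OF summable_norm_sqrt_series])

lemma bounded_linear_sqrt_series: "bounded_linear sqrt_series"
proof (rule bounded_linear_intro)
  fix x y :: 'a and r :: real
  have "(\<lambda>n. sqrt_coeff n *\<^sub>R (B ^^ n) (x + y)) sums (sqrt_series x + sqrt_series y)"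
    using sums_add[OF sums_sqrt_series[of x] sums_sqrt_series[of y]]
    by (simp add: linear_simps[OF bounded_linear_funpow] scaleR_add_right)
  then show "sqrt_series (x + y) = sqrt_series x + sqrt_series y"
    using sums_sqrt_series sums_unique2 by blast
  have "(\<lambda>n. sqrt_coeff n *\<^sub>R (B ^^ n) (r *\<^sub>R x)) sums (r *\<^sub>R sqrt_series x)"
    using sums_scaleR_right[OF sums_sqrt_series[of x], of r]
    by (simp add: linear_simps[OF bounded_linear_funpow] mult.commute)
  then show "sqrt_series (r *\<^sub>R x) = r *\<^sub>R sqrt_series x"
    using sums_sqrt_series sums_unique2 by blast
  have "norm (sqrt_series x) \<le> (\<Sum>n. norm (sqrt_coeff n *\<^sub>R (B ^^ n) x))"
    unfolding sqrt_series_def by (rule summable_norm) (rule summable_norm_sqrt_series)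
  also have "\<dots> \<le> (\<Sum>n. \<bar>sqrt_coeff n\<bar> * norm x)"
    by (intro suminf_le norm_sqrt_series_term summable_norm_sqrt_series summable_mult2
        summable_abs_sqrt_coeff)
  also have "\<dots> = norm x * (\<Sum>n. \<bar>sqrt_coeff n\<bar>)"
    by (simp add: suminf_mult2[OF summable_abs_sqrt_coeff, symmetric])
  finally show "norm (sqrt_series x) \<le> norm x * (\<Sum>n. \<bar>sqrt_coeff n\<bar>)" .
qed

lemma sqrt_series_commute:
  assumes "bounded_linear A" and "\<And>x. A (B x) = B (A x)"
  shows "A (sqrt_series x) = sqrt_series (A x)"
proof -
  interpret A: bounded_linear A by fact
  have comm: "A ((B ^^ n) x) = (B ^^ n) (A x)" for n
    by (induction n) (auto simp: assms(2))
  have "(\<lambda>n. sqrt_coeff n *\<^sub>R (B ^^ n) (A x)) sums A (sqrt_series x)"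
    using A.sums[OF sums_sqrt_series[of x]] by (simp add: A.scaleR comm)
  then show ?thesis
    using sums_sqrt_series sums_unique2 by blast
qed

lemma sqrt_series_symmetric:
  assumes sym: "\<And>x y. inner (B x) y = inner x (B y)"
  shows "inner (sqrt_series x) y = inner x (sqrt_series y)"
proof -
  have pow: "inner ((B ^^ n) x) y = inner x ((B ^^ n) y)" for n x y
    by (induction n arbitrary: x y) (auto simp: sym funpow_swap1)
  have "(\<lambda>n. inner (sqrt_coeff n *\<^sub>R (B ^^ n) x) y) sums inner (sqrt_series x) y"
    by (rule bounded_linear.sums[OF bounded_linear_inner_left sums_sqrt_series])
  moreover have "(\<lambda>n. inner x (sqrt_coeff n *\<^sub>R (B ^^ n) y)) sums inner x (sqrt_series y)"
    by (rule bounded_linear.sums[OF bounded_linear_inner_right sums_sqrt_series])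
  ultimately show ?thesis
    by (simp add: pow sums_unique2)
qed

text \<open>
  The tail of the series satisfies \<open>inner (sqrt_series x) x - inner x x \<ge> - (norm x)\<^sup>2\<close>, because its
  coefficients have absolute sum at most \<open>1\<close> and \<open>B ^^ n\<close> is a contraction.
\<close>

lemma sqrt_series_nonneg: "0 \<le> inner (sqrt_series x) x"
proof -
  have 1: "(\<lambda>n. inner (sqrt_coeff (Suc n) *\<^sub>R (B ^^ Suc n) x) x) sums
      (inner (sqrt_series x) x - inner x x)"
    using bounded_linear.sums[OF bounded_linear_inner_left sums_sqrt_series, of x x]
    by (subst sums_Suc_iff) simp
  have "- (norm x)\<^sup>2 \<le> - (\<Sum>n. \<bar>sqrt_coeff (Suc n)\<bar>) * (norm x)\<^sup>2"
    using mult_right_mono[OF suminf_abs_sqrt_coeff_le zero_le_power2[of "norm x"]] by simp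
  also have "\<dots> \<le> inner (sqrt_series x) x - inner x x"
  proof (rule sums_le[OF _ _ 1])
    show "(\<lambda>n. - \<bar>sqrt_coeff (Suc n)\<bar> * (norm x)\<^sup>2) sums
        (- (\<Sum>n. \<bar>sqrt_coeff (Suc n)\<bar>) * (norm x)\<^sup>2)"
      by (intro sums_mult2 sums_minus summable_sums)
        (use summable_abs_sqrt_coeff in \<open>subst summable_Suc_iff\<close>)
    fix n
    have "inner (sqrt_coeff (Suc n) *\<^sub>R (B ^^ Suc n) x) x \<ge>
        - (norm (sqrt_coeff (Suc n) *\<^sub>R (B ^^ Suc n) x) * norm x)"
      using Cauchy_Schwarz_ineq2[of "sqrt_coeff (Suc n) *\<^sub>R (B ^^ Suc n) x" x] by linarith
    moreover have "norm (sqrt_coeff (Suc n) *\<^sub>R (B ^^ Suc n) x) * norm x \<le>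
        \<bar>sqrt_coeff (Suc n)\<bar> * norm x * norm x"
      by (rule mult_right_mono[OF norm_sqrt_series_term norm_ge_zero])
    ultimately show "- \<bar>sqrt_coeff (Suc n)\<bar> * (norm x)\<^sup>2 \<le>
        inner (sqrt_coeff (Suc n) *\<^sub>R (B ^^ Suc n) x) x"
      by (simp add: power2_eq_square mult.assoc del: funpow.simps)
  qed
  finally show ?thesis by (simp add: power2_norm_eq_inner)
qed

text \<open>
  The double series of the composition converges absolutely, so it can be summed along the diagonals
  \<open>i + j = n\<close>, where the coefficients are those of \<open>1 - t\<close>.
\<close>

lemma sqrt_series_sqrt_series: "sqrt_series (sqrt_series x) = x - B x"
proof -
  interpret S: bounded_linear sqrt_series by (rule bounded_linear_sqrt_series)
  define f where "f = (\<lambda>(i, j). (sqrt_coeff i * sqrt_coeff j) *\<^sub>R (B ^^ (i + j)) x)"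
  define C where "C = (\<Sum>n. \<bar>sqrt_coeff n\<bar>) * norm x"
  have inner_bound: "((\<lambda>j. \<bar>sqrt_coeff i\<bar> * (\<bar>sqrt_coeff j\<bar> * norm x)) has_sum \<bar>sqrt_coeff i\<bar> * C) UNIV"
    for i
  proof (rule norm_summable_imp_has_sum)
    have "(\<lambda>j. \<bar>sqrt_coeff j\<bar> * norm x) sums C"
      unfolding C_def by (rule sums_mult2) (rule summable_sums[OF summable_abs_sqrt_coeff])
    then show "(\<lambda>j. \<bar>sqrt_coeff i\<bar> * (\<bar>sqrt_coeff j\<bar> * norm x)) sums (\<bar>sqrt_coeff i\<bar> * C)"
      by (rule sums_mult)
    then show "summable (\<lambda>j. norm (\<bar>sqrt_coeff i\<bar> * (\<bar>sqrt_coeff j\<bar> * norm x)))"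
      by (simp add: abs_mult sums_iff)
  qed
  have outer_bound: "(\<lambda>i. \<bar>sqrt_coeff i\<bar> * C) summable_on UNIV"
    by (rule norm_summable_imp_summable_on)
      (auto simp: abs_mult intro!: summable_mult2 summable_abs_sqrt_coeff)
  define g where "g = (\<lambda>(i, j). \<bar>sqrt_coeff i\<bar> * (\<bar>sqrt_coeff j\<bar> * norm x))"
  have norm_g: "norm (g (i, j)) = \<bar>sqrt_coeff i\<bar> * (\<bar>sqrt_coeff j\<bar> * norm x)" for i j
    by (simp add: g_def abs_mult)
  have "0 \<le> C"
    unfolding C_def by (intro mult_nonneg_nonneg suminf_nonneg summable_abs_sqrt_coeff) auto
  then have "(\<lambda>z. norm (g z)) summable_on UNIV \<times> UNIV"
    unfolding Infinite_Sum.abs_summable_on_Sigma_iff norm_g infsumI[OF inner_bound]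
    using has_sum_imp_summable[OF inner_bound] outer_bound by (simp add: abs_mult)
  then have "(\<lambda>z. norm (f z)) summable_on UNIV \<times> UNIV"
    by (rule Infinite_Sum.abs_summable_on_comparison_test)
      (auto simp: f_def g_def abs_mult mult.assoc intro!: mult_left_mono norm_funpow_le)
  then have f_summable: "f summable_on UNIV \<times> UNIV"
    by (rule abs_summable_summable)
  have inner_sum: "infsum (\<lambda>j. f (i, j)) UNIV = sqrt_coeff i *\<^sub>R (B ^^ i) (sqrt_series x)" for i
  proof -
    interpret Bi: bounded_linear "B ^^ i" by (rule bounded_linear_funpow)
    have eq: "f (i, j) = sqrt_coeff i *\<^sub>R (B ^^ i) (sqrt_coeff j *\<^sub>R (B ^^ j) x)" for j
      by (simp add: f_def funpow_add Bi.scaleR)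
    show ?thesis
      unfolding eq
      by (intro infsumI has_sum_scaleR has_sum_bounded_linear[OF bounded_linear_funpow]
          norm_summable_imp_has_sum summable_norm_sqrt_series sums_sqrt_series)
  qed
  have "infsum f (UNIV \<times> UNIV) = infsum (\<lambda>i. sqrt_coeff i *\<^sub>R (B ^^ i) (sqrt_series x)) UNIV"
    using infsum_Sigma_banach[OF f_summable] by (simp add: inner_sum)
  also have "\<dots> = sqrt_series (sqrt_series x)"
    by (intro infsumI norm_summable_imp_has_sum summable_norm_sqrt_series sums_sqrt_series)
  finally have lhs: "infsum f (UNIV \<times> UNIV) = sqrt_series (sqrt_series x)" .
  \<comment> \<open>pairs \<open>(i, j)\<close> grouped by \<open>n = i + j\<close>\<close>
  have bij: "bij_betw (\<lambda>(n, i). (i, n - i)) (SIGMA n:UNIV. {..n}) (UNIV \<times> UNIV :: (nat \<times> nat) set)"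
    by (rule bij_betwI[where g = "\<lambda>(i, j). (i + j, i)"]) auto
  have "infsum f (UNIV \<times> UNIV) = infsum (\<lambda>(n, i). f (i, n - i)) (SIGMA n:UNIV. {..n})"
    using infsum_reindex_bij_betw[OF bij, of f] by (simp add: case_prod_unfold)
  also have "\<dots> = infsum (\<lambda>n. infsum (\<lambda>i. f (i, n - i)) {..n}) UNIV"
    using f_summable summable_on_reindex_bij_betw[OF bij, of f]
    by (intro infsum_Sigma'_banach[symmetric]) (simp add: case_prod_unfold)
  also have "\<dots> = infsum (\<lambda>n::nat. (if n = 0 then x else if n = 1 then - B x else 0)) UNIV"
  proof -
    have "infsum (\<lambda>i. f (i, n - i)) {..n} = (if n = 0 then x else if n = 1 then - B x else 0)" for n
    proof -
      have "infsum (\<lambda>i. f (i, n - i)) {..n} =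
          (\<Sum>i\<le>n. sqrt_coeff i * sqrt_coeff (n - i)) *\<^sub>R (B ^^ n) x"
        by (simp add: f_def scaleR_sum_left)
      then show ?thesis
        by (auto simp: sqrt_coeff_convolution)
    qed
    then show ?thesis by simp
  qed
  also have "\<dots> = infsum (\<lambda>n::nat. (if n = 0 then x else if n = 1 then - B x else 0)) {0, 1}"
    by (rule infsum_cong_neutral) auto
  finally show ?thesis using lhs by simp
qed

end


lemma nonneg_symmetric_eq_0:
  fixes S :: "'a :: real_inner \<Rightarrow> 'a"
  assumes "bounded_linear S" "\<And>x y. inner (S x) y = inner x (S y)" "\<And>x. 0 \<le> inner (S x) x"
    and "inner (S x) x = 0"
  shows "S x = 0"
proof -
  obtain K where "0 < K" "\<And>x. norm (S x) \<le> norm x * K"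
    using bounded_linear.pos_bounded[OF assms(1)] by blast
  then have "(norm (S x))\<^sup>2 \<le> K * inner (S x) x"
    by (intro nonneg_symmetric_norm_le assms bounded_linear.linear) (simp_all add: mult.commute)
  then show ?thesis using assms(4) by simp
qed

text \<open>
  If \<open>K\<close> bounds the norm of \<open>R\<close>, then \<open>B = 1 - R / K\<close> is a contraction and \<open>sqrt K\<close> times
  the square root of \<open>1 - B\<close> is a square root of \<open>R\<close>. It is a limit of polynomials in \<open>R\<close>, hence the
  last clause, which serves twice: it makes the square root unique, and complex linear if \<open>R\<close> is.
\<close>

lemma positive_sqrt_exists:
  fixes R :: "'a :: {real_inner, banach} \<Rightarrow> 'a"
  assumes R: "bounded_linear R" "\<And>x y. inner (R x) y = inner x (R y)" "\<And>x. 0 \<le> inner (R x) x"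
  shows "\<exists>S. bounded_linear S \<and> (\<forall>x y. inner (S x) y = inner x (S y)) \<and> (\<forall>x. 0 \<le> inner (S x) x) \<and>
    (\<forall>x. S (S x) = R x) \<and> (\<forall>A. bounded_linear A \<longrightarrow> A \<circ> R = R \<circ> A \<longrightarrow> A \<circ> S = S \<circ> A)"
proof -
  interpret R: bounded_linear R by fact
  obtain K where K: "0 < K" "\<And>x. norm (R x) \<le> norm x * K"
    using R.pos_bounded by blast
  define B where "B = (\<lambda>x. x - (1/K) *\<^sub>R R x)"
  have linB: "bounded_linear B"
    unfolding B_def
    by (intro bounded_linear_sub bounded_linear_ident bounded_linear_const_scaleR R(1))
  have contr: "norm (B x) \<le> norm x" for x
  proof -
    have "(norm (R x))\<^sup>2 \<le> K * inner (R x) x"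
      using K by (intro nonneg_symmetric_norm_le R bounded_linear.linear) (simp_all add: mult.commute)
    then have "(1/K)\<^sup>2 * (norm (R x))\<^sup>2 \<le> (1/K)\<^sup>2 * (K * inner (R x) x)"
      by (rule mult_left_mono) simp
    also have "\<dots> = (1/K) * inner (R x) x"
      using K(1) by (simp add: power2_eq_square)
    finally have "(norm (B x))\<^sup>2 \<le> (norm x)\<^sup>2 - (1/K) * inner (R x) x"
      unfolding power2_norm_eq_inner B_def
      by (simp add: inner_diff_left inner_diff_right inner_commute power2_eq_square)
    also have "\<dots> \<le> (norm x)\<^sup>2" using K(1) R(3)[of x] by simp
    finally show ?thesis by (simp add: power2_le_iff_abs_le)
  qed
  have symB: "inner (B x) y = inner x (B y)" for x y
    by (simp add: B_def inner_diff_left inner_diff_right R(2))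
  interpret Q: bounded_linear "sqrt_series B"
    by (rule bounded_linear_sqrt_series[OF linB contr])
  define S where "S = (\<lambda>x. sqrt K *\<^sub>R sqrt_series B x)"
  show ?thesis
  proof (intro exI[of _ S] conjI)
    show "bounded_linear S"
      unfolding S_def by (intro bounded_linear_const_scaleR Q.bounded_linear_axioms)
    show "\<forall>x y. inner (S x) y = inner x (S y)"
      by (simp add: S_def sqrt_series_symmetric[OF linB contr symB])
    show "\<forall>x. 0 \<le> inner (S x) x"
      using K(1) sqrt_series_nonneg[OF linB contr] by (simp add: S_def)
    show "\<forall>x. S (S x) = R x"
    proof
      fix x
      have "S (S x) = K *\<^sub>R sqrt_series B (sqrt_series B x)"
        using K(1) by (simp add: S_def Q.scaleR)
      also have "\<dots> = R x"
        using K(1) by (simp add: sqrt_series_sqrt_series[OF linB contr]) (simp add: B_def)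
      finally show "S (S x) = R x" .
    qed
    show "\<forall>A. bounded_linear A \<longrightarrow> A \<circ> R = R \<circ> A \<longrightarrow> A \<circ> S = S \<circ> A"
    proof (intro allI impI)
      fix A :: "'a \<Rightarrow> 'a" assume A: "bounded_linear A" "A \<circ> R = R \<circ> A"
      interpret A: bounded_linear A by fact
      have "A (B x) = B (A x)" for x
        using fun_cong[OF A(2), of x] by (simp add: B_def A.diff A.scaleR)
      then show "A \<circ> S = S \<circ> A"
        using sqrt_series_commute[OF linB contr A(1)] by (auto simp: S_def A.scaleR)
    qed
  qed
qed

text \<open>
  For \<open>y = S x - T x\<close> we have \<open>(S + T) y = (S\<^sup>2 - T\<^sup>2) x = 0\<close>. The two nonnegative numbers
  \<open>inner (S y) y\<close> and \<open>inner (T y) y\<close> add up to \<open>0\<close>, so \<open>S y = T y = 0\<close>, and then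
  \<open>inner y y = inner x ((S - T) y) = 0\<close>.
\<close>

lemma commuting_positive_sqrt_unique:
  fixes S T :: "'a :: real_inner \<Rightarrow> 'a"
  assumes S: "bounded_linear S" "\<And>x y. inner (S x) y = inner x (S y)" "\<And>x. 0 \<le> inner (S x) x"
    and T: "bounded_linear T" "\<And>x y. inner (T x) y = inner x (T y)" "\<And>x. 0 \<le> inner (T x) x"
    and comm: "\<And>x. S (T x) = T (S x)" and sq: "\<And>x. S (S x) = T (T x)"
  shows "S = T"
proof
  fix x
  interpret S: bounded_linear S by fact
  interpret T: bounded_linear T by fact
  define y where "y = S x - T x"
  have "S y + T y = 0"
    by (simp add: y_def S.diff T.diff comm sq)
  then have "inner (S y) y + inner (T y) y = 0"
    by (metis inner_add_left inner_zero_left)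
  then have "inner (S y) y = 0" "inner (T y) y = 0"
    using S(3)[of y] T(3)[of y] by linarith+
  then have "S y = 0" "T y = 0"
    using nonneg_symmetric_eq_0[OF S] nonneg_symmetric_eq_0[OF T] by blast+
  then have "inner y y = 0"
    using S(2)[of x y] T(2)[of x y] by (subst (1) y_def) (simp add: inner_diff_left)
  then show "S x = T x" by (simp add: y_def)
qed

section \<open>Operators on complex Hilbert spaces\<close>

lemma cinner_add_right: "cinner z (x + y) = cinner z x + cinner z y"
  by (subst (1 2 3) cinner_commute) (simp add: cinner_add_left)

lemma cinner_scaleC_right: "cinner y (c *\<^sub>C x) = cnj c * cinner y x"
  by (subst (1 2) cinner_commute) (simp add: cinner_scaleC_left)

lemma cinner_minus_left: "cinner (- x) y = - cinner x y"
  using cinner_scaleC_left[of "-1" x y] by simp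

lemma cinner_minus_right: "cinner x (- y) = - cinner x y"
  using cinner_scaleC_right[of x "-1" y] by simp

lemma cinner_diff_left: "cinner (x - y) z = cinner x z - cinner y z"
  using cinner_add_left[of x "- y" z] by (simp add: cinner_minus_left)

lemma cinner_diff_right: "cinner z (x - y) = cinner z x - cinner z y"
  using cinner_add_right[of z x "- y"] by (simp add: cinner_minus_right)

lemma cinner_zero_left [simp]: "cinner 0 x = 0"
  using cinner_diff_left[of x x x] by simp

lemma cinner_zero_right [simp]: "cinner x 0 = 0"
  using cinner_diff_right[of x x x] by simp

lemma cinner_sum_left: "cinner (sum f A) y = (\<Sum>i\<in>A. cinner (f i) y)"
  by (induction A rule: infinite_finite_induct) (auto simp: cinner_add_left)

lemma Im_cinner: "Im (cinner x y) = inner ((- \<i>) *\<^sub>C x) y"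
  by (simp add: inner_cinner cinner_scaleC_left cinner_minus_left)

text \<open>
  The complex inner product is recovered from its real part. This carries orthogonality to a complex
  subspace, and adjoints of complex linear operators, from the real to the complex setting.
\<close>

lemma cinner_conv_inner: "cinner x y = Complex (inner x y) (inner ((- \<i>) *\<^sub>C x) y)"
  by (simp add: complex_eq_iff Im_cinner inner_cinner)

lemma cinner_self: "cinner x x = complex_of_real ((norm x)\<^sup>2)"
proof -
  have "Im (cinner x x) = 0" using arg_cong[OF cinner_commute[of x x], of Im] by simp
  then show ?thesis by (simp add: complex_eq_iff power2_norm_eq_inner inner_cinner)
qed

lemma norm_scaleC: "norm (c *\<^sub>C x) = cmod c * norm (x :: 'a :: complex_inner)"
proof -
  have "complex_of_real ((norm (c *\<^sub>C x))\<^sup>2) = (c * cnj c) * cinner x x"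
    unfolding cinner_self[symmetric] by (simp add: cinner_scaleC_left cinner_scaleC_right)
  also have "\<dots> = complex_of_real ((cmod c * norm x)\<^sup>2)"
    by (simp only: cinner_self complex_norm_square[symmetric] power_mult_distrib of_real_mult)
  finally have "complex_of_real ((norm (c *\<^sub>C x))\<^sup>2) = complex_of_real ((cmod c * norm x)\<^sup>2)" .
  then show ?thesis
    by (simp only: of_real_eq_iff) (simp add: power2_eq_iff_nonneg)
qed

lemma cmod_cinner_le: "cmod (cinner x y) \<le> norm x * norm y"
proof (cases "cinner x y = 0")
  case False
  define c where "c = cnj (cinner x y) / cmod (cinner x y)"
  have c: "cmod c = 1" using False by (simp add: c_def norm_divide)
  have "cinner (c *\<^sub>C x) y = cmod (cinner x y)"
    using False complex_norm_square[of "cinner x y"]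
    by (simp add: c_def cinner_scaleC_left power2_eq_square field_simps)
  then have "cmod (cinner x y) = inner (c *\<^sub>C x) y" by (simp add: inner_cinner)
  also have "\<dots> \<le> norm (c *\<^sub>C x) * norm y" by (rule norm_cauchy_schwarz)
  finally show ?thesis by (simp add: norm_scaleC c)
qed simp

lemma bounded_linear_cinner_left: "bounded_linear (\<lambda>x. cinner x y)"
proof (rule bounded_linear_intro)
  show "norm (cinner x y) \<le> norm x * norm y" for x by (rule cmod_cinner_le)
qed (auto simp: cinner_add_left scaleR_scaleC cinner_scaleC_left scaleC_complex_def)

lemma bounded_linear_scaleC_right: "bounded_linear ((*\<^sub>C) c :: 'a :: complex_inner \<Rightarrow> 'a)"
  by (rule bounded_linear_intro[where K = "cmod c"])
    (auto simp: scaleC_add_right scaleR_scaleC scaleC_scaleC norm_scaleC mult.commute)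

lemma csubspace_imp_subspace: "csubspace V \<Longrightarrow> subspace V"
  unfolding complex_vector.subspace_def subspace_def by (simp add: scaleR_scaleC)

lemma subspace_closure:
  fixes V :: "'a :: real_normed_vector set"
  assumes "subspace V"
  shows "subspace (closure V)"
  unfolding subspace_def
proof (intro conjI ballI allI)
  show "0 \<in> closure V" using assms closure_subset subspace_0 by blast
next
  fix x y assume "x \<in> closure V" "y \<in> closure V"
  then obtain f g where "\<And>n. f n \<in> V" "f \<longlonglongrightarrow> x" "\<And>n. g n \<in> V" "g \<longlonglongrightarrow> y"
    unfolding closure_sequential by blast
  then show "x + y \<in> closure V"
    unfolding closure_sequential using tendsto_add subspace_add[OF assms]
    by (intro exI[of _ "\<lambda>n. f n + g n"]) auto
next
  fix x and c :: real assume "x \<in> closure V"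
  then obtain f where "\<And>n. f n \<in> V" "f \<longlonglongrightarrow> x"
    unfolding closure_sequential by blast
  then show "c *\<^sub>R x \<in> closure V"
    unfolding closure_sequential using subspace_scale[OF assms]
    by (intro exI[of _ "\<lambda>n. c *\<^sub>R f n"]) (auto intro: tendsto_scaleR)
qed

lemma cinner_eq_0_if_inner_eq_0:
  assumes "csubspace V" "\<And>y. y \<in> V \<Longrightarrow> inner y z = 0" "y \<in> V"
  shows "cinner y z = 0"
  using assms complex_vector.subspace_scale[OF assms(1,3)] by (simp add: cinner_conv_inner zero_complex.code)

lemma bounded_clinearD:
  assumes "bounded_clinear A"
  shows "bounded_linear A" "A (c *\<^sub>C x) = c *\<^sub>C A x"
  using assms by (auto simp: bounded_clinear_def)

lemma cadjoint_unique:
  assumes "\<And>x y. cinner (A x) y = cinner x (B y)"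
  shows "cadjoint A = B"
  unfolding cadjoint_def
proof (rule the_equality)
  fix C assume C: "\<forall>x y. cinner (A x) y = cinner x (C y)"
  have "cinner x (C y - B y) = 0" for x y
    using C assms[of x y] by (simp add: cinner_diff_right)
  then have "cinner (C y - B y) (C y - B y) = 0" for y by blast
  then show "C = B" by (auto simp: cinner_self)
qed (use assms in blast)

lemma cinner_adjointI:
  assumes "\<And>c x. A (c *\<^sub>C x) = c *\<^sub>C A x" "\<And>x y. inner (A x) y = inner x (B y)"
  shows "cinner (A x) y = cinner x (B y)"
  by (simp add: cinner_conv_inner assms(2) flip: assms(1))

text \<open>
  The real adjoint of a complex linear operator is its complex adjoint.
\<close>

lemma cadjoint_works:
  fixes A :: "'a :: complex_hilbert_space \<Rightarrow> 'a"
  assumes "bounded_clinear A"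
  shows "cinner (A x) y = cinner x (cadjoint A y)"
proof -
  obtain B where "\<forall>x y. inner (A x) y = inner x (B y)"
    using real_adjoint_exists[OF bounded_clinearD(1)[OF assms]] by blast
  then have B: "cinner (A x) y = cinner x (B y)" for x y
    by (intro cinner_adjointI) (auto simp: bounded_clinearD(2)[OF assms])
  show ?thesis using B by (simp add: cadjoint_unique[OF B])
qed

lemma self_adjoint_iff:
  fixes A :: "'a :: complex_hilbert_space \<Rightarrow> 'a"
  assumes "bounded_clinear A"
  shows "self_adjoint A \<longleftrightarrow> (\<forall>x y. inner (A x) y = inner x (A y))"
proof
  show "\<forall>x y. inner (A x) y = inner x (A y)" if "self_adjoint A"
    using cadjoint_works[OF assms] that by (auto simp: self_adjoint_def inner_cinner)
  show "self_adjoint A" if "\<forall>x y. inner (A x) y = inner x (A y)"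
    unfolding self_adjoint_def
    by (intro cadjoint_unique cinner_adjointI) (use assms that in \<open>auto simp: bounded_clinear_def\<close>)
qed

lemma nonneg_op_iff:
  fixes A :: "'a :: complex_hilbert_space \<Rightarrow> 'a"
  assumes "bounded_clinear A" "self_adjoint A"
  shows "nonneg_op A \<longleftrightarrow> (\<forall>x. 0 \<le> inner (A x) x)"
proof -
  have "Im (cinner (A x) x) = 0" for x
  proof -
    have "cinner (A x) x = cinner x (A x)"
      using cadjoint_works[OF assms(1), of x x] assms(2) by (simp add: self_adjoint_def)
    also have "\<dots> = cnj (cinner (A x) x)" by (rule cinner_commute)
    finally have "Im (cinner (A x) x) = Im (cnj (cinner (A x) x))" by (rule arg_cong)
    then show ?thesis by simp
  qed
  then show ?thesis by (simp add: nonneg_op_def less_eq_complex_def inner_cinner)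
qed


lemma positive_opD:
  fixes A :: "'a :: complex_hilbert_space \<Rightarrow> 'a"
  assumes "bounded_clinear A" "self_adjoint A" "nonneg_op A"
  shows "bounded_linear A" "inner (A x) y = inner x (A y)" "0 \<le> inner (A x) x"
proof -
  show "bounded_linear A" using assms(1) by (rule bounded_clinearD)
  show "inner (A x) y = inner x (A y)" using assms(2) self_adjoint_iff[OF assms(1)] by blast
  show "0 \<le> inner (A x) x" using assms(3) nonneg_op_iff[OF assms(1,2)] by blast
qed

text \<open>
  The nonnegative square root exists and is unique, so the definite description denotes it. Any
  other root \<open>T\<close> commutes with \<open>R = T \<circ> T\<close>, hence with the root given by the series.
\<close>

lemma op_sqrt_properties:
  fixes R :: "'a :: complex_hilbert_space \<Rightarrow> 'a"
  assumes R: "bounded_clinear R" "self_adjoint R" "nonneg_op R"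
  shows "bounded_clinear (op_sqrt R)" "self_adjoint (op_sqrt R)"
    and "op_sqrt R (op_sqrt R x) = R x"
proof -
  obtain S where S: "bounded_linear S" "\<And>x y. inner (S x) y = inner x (S y)"
      "\<And>x. 0 \<le> inner (S x) x" and SS: "\<And>x. S (S x) = R x"
    and comm: "\<forall>A. bounded_linear A \<longrightarrow> A \<circ> R = R \<circ> A \<longrightarrow> A \<circ> S = S \<circ> A"
    using positive_sqrt_exists[OF positive_opD[OF R]] by (elim exE conjE) blast
  have clin: "bounded_clinear S"
  proof -
    have "(*\<^sub>C) c \<circ> R = R \<circ> (*\<^sub>C) c" for c
      using bounded_clinearD(2)[OF R(1)] by auto
    then have "(*\<^sub>C) c \<circ> S = S \<circ> (*\<^sub>C) c" for c
      using comm bounded_linear_scaleC_right by blast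
    then show ?thesis
      using S(1) by (simp add: bounded_clinear_def fun_eq_iff)
  qed
  have sa: "self_adjoint S" using S(2) clin self_adjoint_iff by blast
  have "op_sqrt R = S"
    unfolding op_sqrt_def
  proof (rule the_equality)
    show "bounded_clinear S \<and> self_adjoint S \<and> nonneg_op S \<and> S \<circ> S = R"
      using clin sa S(3) nonneg_op_iff[OF clin sa] SS by auto
    fix T assume T: "bounded_clinear T \<and> self_adjoint T \<and> nonneg_op T \<and> T \<circ> T = R"
    then have TT: "T (T x) = R x" for x by (auto simp: o_def)
    from T have "bounded_clinear T" "self_adjoint T" "nonneg_op T" by auto
    note T' = positive_opD[OF this]
    have "T \<circ> R = R \<circ> T" by (auto simp flip: TT)
    then have "T \<circ> S = S \<circ> T" using comm T'(1) by blast
    then have "T (S x) = S (T x)" for x by (metis comp_apply)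
    then show "T = S"
      by (intro commuting_positive_sqrt_unique[OF T' S]) (simp_all add: TT SS)
  qed
  then show "bounded_clinear (op_sqrt R)" "self_adjoint (op_sqrt R)"
    "op_sqrt R (op_sqrt R x) = R x"
    using clin sa SS by simp_all
qed

text \<open>
  A vector outside the closed span differs from its projection onto it by a nonzero vector that
  is orthogonal to \<open>X\<close>.
\<close>

lemma closure_cspan_eq_UNIV_iff:
  fixes X :: "'a :: complex_hilbert_space set"
  shows "closure (cspan X) = UNIV \<longleftrightarrow> (\<forall>y. (\<forall>x\<in>X. cinner x y = 0) \<longrightarrow> y = 0)"
proof (intro iffI allI impI)
  fix y assume dense: "closure (cspan X) = UNIV" and orth: "\<forall>x\<in>X. cinner x y = 0"
  have "cspan X \<subseteq> {x. cinner x y = 0}"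
    by (rule complex_vector.span_minimal)
      (use orth in \<open>auto simp: complex_vector.subspace_def cinner_add_left cinner_scaleC_left\<close>)
  moreover have "closed {x. cinner x y = 0}"
    by (intro closed_Collect_eq continuous_on_const
        bounded_linear.continuous_on[OF bounded_linear_cinner_left] continuous_on_id)
  ultimately have "y \<in> {x. cinner x y = 0}"
    using closure_minimal dense by blast
  then show "y = 0" by (simp add: cinner_self)
next
  assume trivial: "\<forall>y. (\<forall>x\<in>X. cinner x y = 0) \<longrightarrow> y = 0"
  have sub: "csubspace (cspan X)" by (rule complex_vector.subspace_span)
  have "x \<in> closure (cspan X)" for x
  proof -
    have "subspace (closure (cspan X))"
      using csubspace_imp_subspace[OF sub] by (rule subspace_closure)
    then obtain p where p: "p \<in> closure (cspan X)" "\<And>y. y \<in> closure (cspan X) \<Longrightarrow> inner (x - p) y = 0"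
      using orthogonal_projection_exists closed_closure by blast
    have "inner y (x - p) = 0" if "y \<in> cspan X" for y
      using p(2)[of y] that closure_subset by (auto simp: inner_commute)
    then have "cinner y (x - p) = 0" if "y \<in> X" for y
      using cinner_eq_0_if_inner_eq_0[OF sub] that by (simp add: complex_vector.span_base)
    then show ?thesis using trivial p(1) by force
  qed
  then show "closure (cspan X) = UNIV" by blast
qed

lemma ker_closed_csubspace:
  assumes "bounded_clinear A"
  shows "closed (ker A)" "csubspace (ker A)"
proof -
  interpret A: bounded_linear A using bounded_clinearD(1)[OF assms] .
  show "closed (ker A)"
    unfolding ker_def by (intro closed_Collect_eq continuous_on_const A.continuous_on continuous_on_id)
  show "csubspace (ker A)"
    using bounded_clinearD(2)[OF assms]
    by (auto simp: ker_def complex_vector.subspace_def A.zero A.add)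
qed

lemma bounded_clinear_comp:
  "bounded_clinear A \<Longrightarrow> bounded_clinear B \<Longrightarrow> bounded_clinear (A \<circ> B)"
  unfolding bounded_clinear_def o_def by (auto intro: bounded_linear_compose)

lemma bounded_clinear_funpow:
  fixes A :: "'a :: complex_inner \<Rightarrow> 'a"
  shows "bounded_clinear A \<Longrightarrow> bounded_clinear (A ^^ n)"
proof (induction n)
  case 0
  then show ?case by (simp add: bounded_clinear_def id_def)
next
  case (Suc n)
  then show ?case using bounded_clinear_comp[of A "A ^^ n"] by (simp add: o_def)
qed

lemma cinner_funpow:
  fixes A B :: "'a :: complex_inner \<Rightarrow> 'a"
  assumes "\<And>x y. cinner (A x) y = cinner x (B y)"
  shows "cinner ((A ^^ n) x) y = cinner x ((B ^^ n) y)"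
  by (induction n arbitrary: x y) (auto simp: assms funpow_swap1)

section \<open>The conditions for a fixed pair of operators\<close>

context
  fixes J R :: "'a :: complex_hilbert_space \<Rightarrow> 'a"
  assumes J: "bounded_clinear J" "skew_adjoint J"
    and R: "bounded_clinear R" "self_adjoint R" "nonneg_op R"
begin

lemma cinner_op_sqrt: "cinner (op_sqrt R x) y = cinner x (op_sqrt R y)"
  using cadjoint_works[OF op_sqrt_properties(1)[OF R]] op_sqrt_properties(2)[OF R]
  by (simp add: self_adjoint_def)

lemma cinner_pos_op: "cinner (R x) x = complex_of_real ((norm (op_sqrt R x))\<^sup>2)"
  by (simp only: op_sqrt_properties(3)[OF R, symmetric] cinner_op_sqrt cinner_self)

lemma op_sqrt_eq_0_iff: "op_sqrt R x = 0 \<longleftrightarrow> R x = 0"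
proof
  assume "op_sqrt R x = 0"
  then have "R x = op_sqrt R 0" by (metis op_sqrt_properties(3)[OF R])
  then show "R x = 0"
    using op_sqrt_properties(1)[OF R] linear_simps(3) bounded_clinearD(1) by metis
next
  assume "R x = 0"
  then show "op_sqrt R x = 0" using cinner_pos_op[of x] by simp
qed

lemma cadjoint_skew: "cadjoint J x = - J x"
  using J(2) by (simp add: skew_adjoint_def)

lemma cadjoint_skew_bounded_clinear: "bounded_clinear (cadjoint J)"
proof -
  have "cadjoint J = (\<lambda>x. - J x)" using J(2) by (simp add: skew_adjoint_def)
  then show ?thesis
    using J(1) by (simp add: bounded_clinear_def bounded_linear_minus)
qed

lemma B1_iff_B2: "B1 J R \<longleftrightarrow> B2 J R"
proof -
  have "(\<forall>u. cinner ((J ^^ j) (op_sqrt R u)) y = 0) \<longleftrightarrow> op_sqrt R ((cadjoint J ^^ j) y) = 0" for j y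
  proof -
    have eq: "cinner ((J ^^ j) (op_sqrt R u)) y = cinner u (op_sqrt R ((cadjoint J ^^ j) y))" for u
      by (simp add: cinner_funpow[OF cadjoint_works[OF J(1)]] cinner_op_sqrt)
    show ?thesis
      unfolding eq using cinner_self[of "op_sqrt R ((cadjoint J ^^ j) y)"] by force
  qed
  then have "closure (cspan (\<Union>j\<in>{j. enat j \<le> m}. range ((J ^^ j) \<circ> op_sqrt R))) = UNIV \<longleftrightarrow>
      (\<Inter>j\<in>{j. enat j \<le> m}. ker (op_sqrt R \<circ> (cadjoint J ^^ j))) \<subseteq> {0}" for m
    unfolding closure_cspan_eq_UNIV_iff by (auto simp: ker_def)
  moreover have "0 \<in> (\<Inter>j\<in>{j. enat j \<le> m}. ker (op_sqrt R \<circ> (cadjoint J ^^ j)))" for m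
    using ker_closed_csubspace(2)[OF bounded_clinear_comp[OF op_sqrt_properties(1)[OF R]
          bounded_clinear_funpow[OF cadjoint_skew_bounded_clinear]]]
    by (blast intro: complex_vector.subspace_0)
  moreover have "A \<subseteq> {0} \<longleftrightarrow> A = {0}" if "0 \<in> A" for A :: "'a set"
    using that by blast
  ultimately show ?thesis
    unfolding B1_def B2_def by simp
qed

lemma B2_iff_B3: "B2 J R \<longleftrightarrow> B3 J R"
proof -
  have eq: "0 < cinner ((J ^^ j) (R ((cadjoint J ^^ j) x))) x \<longleftrightarrow> op_sqrt R ((cadjoint J ^^ j) x) \<noteq> 0"
    for j x
    by (simp add: cinner_funpow[OF cadjoint_works[OF J(1)]] cinner_pos_op less_complex_def
        del: of_real_power)
  have "op_sqrt R ((cadjoint J ^^ j) 0) = 0" for j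
    using ker_closed_csubspace(2)[OF bounded_clinear_comp[OF op_sqrt_properties(1)[OF R]
          bounded_clinear_funpow[OF cadjoint_skew_bounded_clinear]], of j]
    by (auto simp: ker_def dest: complex_vector.subspace_0)
  then have "(\<Inter>j\<in>{j. enat j \<le> m}. ker (op_sqrt R \<circ> (cadjoint J ^^ j))) = {0} \<longleftrightarrow>
      (\<forall>x. x \<noteq> 0 \<longrightarrow> (\<exists>j. enat j \<le> m \<and> op_sqrt R ((cadjoint J ^^ j) x) \<noteq> 0))" for m
    by (auto simp: ker_def set_eq_iff)
  then show ?thesis
    unfolding B2_def B3_def eq by simp
qed

text \<open>
  An invariant subspace of \<open>ker R\<close> is contained in the intersection in \<open>B2\<close> for every \<open>m\<close>. Conversely,
  the intersection over all \<open>j\<close>, that is for \<open>m = \<infinity>\<close>, is itself closed, invariant and inside \<open>ker R\<close>.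
\<close>

lemma B2_iff_B4: "B2 J R \<longleftrightarrow> B4 J R"
proof
  assume "B2 J R"
  then obtain m where m: "(\<Inter>j\<in>{j::nat. enat j \<le> m}. ker (op_sqrt R \<circ> (cadjoint J ^^ j))) = {0}"
    unfolding B2_def by blast
  show "B4 J R"
    unfolding B4_def
  proof (intro allI impI)
    fix V assume V: "csubspace V \<and> closed V \<and> V \<subseteq> ker R \<and> J ` V \<subseteq> V"
    have "(cadjoint J ^^ j) x \<in> V" if "x \<in> V" for x j
    proof (induction j)
      case (Suc j)
      have "(cadjoint J ^^ Suc j) x = - J ((cadjoint J ^^ j) x)"
        by (simp only: funpow.simps comp_apply cadjoint_skew)
      then show ?case
        using V Suc complex_vector.subspace_neg[of V "J ((cadjoint J ^^ j) x)"] by auto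
    qed (use that in simp)
    then have "V \<subseteq> {0}"
      using V unfolding m[symmetric] by (auto simp: ker_def op_sqrt_eq_0_iff)
    then show "V = {0}"
      using V complex_vector.subspace_0 by blast
  qed
next
  assume B4: "B4 J R"
  define W where "W = (\<Inter>j. ker (op_sqrt R \<circ> (cadjoint J ^^ j)))"
  have bcl: "bounded_clinear (op_sqrt R \<circ> (cadjoint J ^^ j))" for j
    by (intro bounded_clinear_comp bounded_clinear_funpow op_sqrt_properties(1)[OF R]
        cadjoint_skew_bounded_clinear)
  have "csubspace W"
    unfolding W_def by (rule complex_vector.subspace_Inter) (use bcl ker_closed_csubspace in blast)
  moreover have "closed W"
    unfolding W_def using bcl ker_closed_csubspace by blast
  moreover have "W \<subseteq> ker R"
  proof
    fix x assume "x \<in> W"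
    then have "x \<in> ker (op_sqrt R \<circ> (cadjoint J ^^ 0))" unfolding W_def by blast
    then show "x \<in> ker R" by (simp add: ker_def op_sqrt_eq_0_iff)
  qed
  moreover have "J x \<in> W" if x: "x \<in> W" for x
  proof -
    have "cadjoint J x \<in> W"
    proof -
      have "op_sqrt R ((cadjoint J ^^ Suc j) x) = 0" for j
        using x unfolding W_def by (auto simp: ker_def simp del: funpow.simps)
      then show ?thesis
        by (simp add: W_def ker_def funpow_swap1)
    qed
    then show ?thesis
      using complex_vector.subspace_neg[OF \<open>csubspace W\<close>, of "cadjoint J x"] by (simp add: cadjoint_skew)
  qed
  ultimately have "W = {0}"
    using B4 unfolding B4_def by blast
  then show "B2 J R"
    unfolding B2_def by (intro exI[of _ \<infinity>]) (simp add: W_def)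
qed

lemma B4_imp_B5: "B4 J R \<Longrightarrow> B5 J R"
proof -
  assume B4: "B4 J R"
  have "x = 0" if x: "J x = \<mu> *\<^sub>C x" "x \<in> ker R" for \<mu> x
  proof -
    define V where "V = ker (\<lambda>y. J y - \<mu> *\<^sub>C y) \<inter> ker R"
    have "bounded_clinear (\<lambda>y. J y - \<mu> *\<^sub>C y)"
      using J(1) bounded_linear_scaleC_right[of \<mu>]
      by (auto simp: bounded_clinear_def complex_vector.scale_right_diff_distrib
          scaleC_scaleC mult.commute intro!: bounded_linear_sub)
    then have "csubspace V \<and> closed V"
      unfolding V_def using ker_closed_csubspace R(1)
      by (blast intro: complex_vector.subspace_inter)
    moreover have "V \<subseteq> ker R" by (simp add: V_def)
    moreover have "J ` V \<subseteq> V"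
      using bounded_clinearD(2)[OF J(1)] bounded_clinearD(2)[OF R(1)]
      by (auto simp: V_def ker_def)
    ultimately have "V = {0}" using B4 unfolding B4_def by blast
    then show ?thesis using x by (auto simp: V_def ker_def)
  qed
  then show "B5 J R" unfolding B5_def is_eigenvector_def by blast
qed

end

section \<open>Eigenvectors in finite-dimensional invariant subspaces\<close>

text \<open>
  If \<open>p(J) w = 0\<close> and \<open>p = (X - r) q\<close>, then \<open>u = q(J) w\<close> satisfies \<open>(J - r) u = 0\<close>: either \<open>u\<close> is an
  eigenvector, or \<open>q\<close> annihilates \<open>w\<close> and has smaller degree. The sum runs up to a
  bound on the degree so that \<open>p\<close> and \<open>q\<close> fit the same pattern.
\<close>

lemma eigenvector_from_annihilating_polynomial:
  fixes J :: "'a :: complex_inner \<Rightarrow> 'a" and p :: "complex poly"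
  assumes J: "bounded_clinear J" and V: "csubspace V" "J ` V \<subseteq> V"
    and "degree p \<le> n" "p \<noteq> 0" "w \<in> V" "w \<noteq> 0"
    and "(\<Sum>i\<le>n. coeff p i *\<^sub>C (J ^^ i) w) = 0"
  shows "\<exists>u\<in>V. is_eigenvector J u"
  using assms(4-)
proof (induction n arbitrary: p)
  case 0
  then have "coeff p 0 = 0" by (simp add: complex_vector.scale_eq_0_iff)
  moreover have "coeff p 0 \<noteq> 0" using 0 by (metis le_zero_eq leading_coeff_0_iff)
  ultimately show ?case by blast
next
  case (Suc n)
  interpret J: bounded_linear J using bounded_clinearD(1)[OF J] .
  have powV: "(J ^^ i) w \<in> V" for i
    by (induction i) (use V Suc.prems in auto)
  show ?case
  proof (cases "degree p = 0")
    case True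
    then obtain c where p: "p = [:c:]" using degree_eq_zeroE by blast
    have "(\<Sum>i\<le>Suc n. coeff p i *\<^sub>C (J ^^ i) w) = c *\<^sub>C w"
      by (subst sum.atMost_Suc_shift) (simp add: p)
    then show ?thesis
      using Suc.prems p by (simp add: complex_vector.scale_eq_0_iff)
  next
    case False
    then obtain r where "poly p r = 0"
      using fundamental_theorem_of_algebra constant_degree by metis
    then obtain q where q: "p = [:- r, 1:] * q" by (auto simp: poly_eq_0_iff_dvd dvd_def)
    have q0: "q \<noteq> 0" using Suc.prems q by auto
    have degq: "degree q \<le> n"
      using Suc.prems(1) q0 unfolding q by (subst (asm) degree_mult_eq) auto
    define u where "u = (\<Sum>i\<le>n. coeff q i *\<^sub>C (J ^^ i) w)"
    have uV: "u \<in> V"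
      unfolding u_def using V powV
      by (auto intro!: complex_vector.subspace_sum complex_vector.subspace_scale)
    have "(\<Sum>i\<le>Suc n. coeff (pCons 0 q) i *\<^sub>C (J ^^ i) w) = J u"
      by (subst sum.atMost_Suc_shift) (simp add: u_def J.sum bounded_clinearD(2)[OF J])
    moreover have "(\<Sum>i\<le>Suc n. (- r * coeff q i) *\<^sub>C (J ^^ i) w) = (- r) *\<^sub>C u"
      using degq by (simp add: u_def coeff_eq_0 complex_vector.scale_sum_right scaleC_scaleC sum_negf)
    moreover have "coeff p i = - r * coeff q i + coeff (pCons 0 q) i" for i
      by (simp add: q)
    ultimately have "J u = r *\<^sub>C u"
      using Suc.prems(5)
      by (simp only: scaleC_add_left sum.distrib) (simp add: eq_neg_iff_add_eq_0)
    then show ?thesis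
      using Suc.IH[OF degq q0] Suc.prems uV unfolding is_eigenvector_def u_def by blast
  qed
qed

text \<open>
  Stated for a family and not for a set: the orbit \<open>w, J w, J\<^sup>2 w, \<dots>\<close> may repeat, and a
  repetition is itself a relation.
\<close>

lemma nontrivial_relation_of_many_vectors:
  fixes f :: "nat \<Rightarrow> 'a :: complex_inner"
  assumes "finite B" "range f \<subseteq> cspan B"
  shows "\<exists>c. (\<exists>i\<le>card B. c i \<noteq> 0) \<and> (\<Sum>i\<le>card B. c i *\<^sub>C f i) = 0"
proof (cases "inj_on f {..card B}")
  case True
  let ?S = "f ` {..card B}"
  have "card ?S = Suc (card B)" using True by (simp add: card_image)
  then have "complex_vector.dependent ?S"
    using complex_vector.independent_span_bound[OF assms(1), of ?S] assms(2) by force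
  then obtain u where u: "\<exists>v\<in>?S. u v \<noteq> 0" "(\<Sum>v\<in>?S. u v *\<^sub>C v) = 0"
    using complex_vector.dependent_finite[of ?S] by auto
  then show ?thesis
    using True by (intro exI[of _ "u \<circ> f"]) (auto simp: sum.reindex)
next
  case False
  then obtain i j where ij: "i \<le> card B" "j \<le> card B" "i \<noteq> j" "f i = f j"
    by (auto simp: inj_on_def)
  define c :: "nat \<Rightarrow> complex" where "c = (\<lambda>k. (if k = i then 1 else 0) - (if k = j then 1 else 0))"
  have "(\<Sum>k\<le>card B. c k *\<^sub>C f k) = 0"
    using ij by (simp add: c_def complex_vector.scale_left_diff_distrib sum_subtractf if_distrib[of "\<lambda>c. c *\<^sub>C _"]
        cong: if_cong)
  then show ?thesis using ij by (intro exI[of _ c]) (auto simp: c_def)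
qed

lemma finite_dimensional_invariant_eigenvector:
  fixes J :: "'a :: complex_inner \<Rightarrow> 'a"
  assumes J: "bounded_clinear J" and V: "csubspace V" "J ` V \<subseteq> V" "V \<noteq> {0}"
    and B: "finite B" "V \<subseteq> cspan B"
  shows "\<exists>u\<in>V. is_eigenvector J u"
proof -
  obtain w where w: "w \<in> V" "w \<noteq> 0"
    using V(1,3) complex_vector.subspace_0 by blast
  have "(J ^^ i) w \<in> V" for i
    by (induction i) (use V w in auto)
  then obtain c where c: "\<exists>i\<le>card B. c i \<noteq> 0" "(\<Sum>i\<le>card B. c i *\<^sub>C (J ^^ i) w) = 0"
    using nontrivial_relation_of_many_vectors[OF B(1), of "\<lambda>i. (J ^^ i) w"] B(2) by blast
  define p where "p = (\<Sum>i\<le>card B. monom (c i) i)"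
  have coeff: "coeff p i = (if i \<le> card B then c i else 0)" for i
    by (simp add: p_def coeff_sum)
  show ?thesis
  proof (rule eigenvector_from_annihilating_polynomial[OF J V(1,2), of p "card B"])
    show "degree p \<le> card B" by (rule degree_le) (simp add: coeff)
    show "p \<noteq> 0" using c(1) coeff by (metis coeff_0)
    show "(\<Sum>i\<le>card B. coeff p i *\<^sub>C (J ^^ i) w) = 0" using c(2) by (simp add: coeff)
  qed (use w in auto)
qed

section \<open>Maximal orthonormal sets\<close>

definition orthonormal_set :: "'a :: complex_inner set \<Rightarrow> bool"
  where "orthonormal_set E \<longleftrightarrow> (\<forall>e\<in>E. \<forall>f\<in>E. cinner e f = of_bool (e = f))"

text \<open>
  Distinct orthonormal vectors have distance \<open>sqrt 2\<close>, so points of a dense set within \<open>1/2\<close> of them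
  are distinct as well.
\<close>

lemma countable_orthonormal_set:
  fixes E :: "'a :: complex_inner set"
  assumes "separable_space (euclidean :: 'a topology)" "orthonormal_set E"
  shows "countable E"
proof -
  obtain D :: "'a set" where D: "countable D" "closure D = UNIV"
    using assms(1) unfolding separable_space_def by auto
  have "\<exists>d\<in>D. dist d e < 1/2" for e
    using closure_approachable[of e D] D(2) by (metis UNIV_I half_gt_zero zero_less_one)
  then obtain d where d: "\<And>e. d e \<in> D" "\<And>e. dist (d e) e < 1/2"
    by metis
  have "inj_on d E"
  proof (rule inj_onI, rule ccontr)
    fix e f assume ef: "e \<in> E" "f \<in> E" "d e = d f" "e \<noteq> f"
    have "dist e f < 1"
      using dist_triangle_half_r[of "d e" e 1 f] d(2)[of e] d(2)[of f] ef(3) by simp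
    then have "(norm (e - f))\<^sup>2 < 1"
      by (simp add: dist_norm abs_square_less_1)
    moreover have "(norm (e - f))\<^sup>2 = 2"
      using assms(2) ef unfolding orthonormal_set_def power2_norm_eq_inner inner_cinner
      by (simp add: cinner_diff_left cinner_diff_right)
    ultimately show False by simp
  qed
  moreover have "d ` E \<subseteq> D" using d(1) by blast
  ultimately show ?thesis
    using D(1) countable_image_inj_on countable_subset by blast
qed

text \<open>
  By Zorn's lemma; a nonzero vector orthogonal to a maximal set could be normalised and added.
\<close>

lemma maximal_orthonormal_set_exists:
  fixes V :: "'a :: complex_inner set"
  assumes "csubspace V"
  shows "\<exists>E\<subseteq>V. orthonormal_set E \<and> (\<forall>x\<in>V. (\<forall>e\<in>E. cinner x e = 0) \<longrightarrow> x = 0)"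
proof -
  have "\<exists>M\<in>{E. E \<subseteq> V \<and> orthonormal_set E}. \<forall>X\<in>{E. E \<subseteq> V \<and> orthonormal_set E}. M \<subseteq> X \<longrightarrow> X = M"
  proof (rule subset_Zorn')
    fix C assume C: "subset.chain {E. E \<subseteq> V \<and> orthonormal_set E} C"
    have "cinner e f = of_bool (e = f)" if ef: "e \<in> \<Union> C" "f \<in> \<Union> C" for e f
    proof -
      obtain X Y where XY: "e \<in> X" "X \<in> C" "f \<in> Y" "Y \<in> C" using ef by blast
      then have "X \<subseteq> Y \<or> Y \<subseteq> X" using C unfolding subset.chain_def by blast
      then obtain Z where "e \<in> Z" "f \<in> Z" "Z \<in> C" using XY by blast
      then show ?thesis using C unfolding subset.chain_def orthonormal_set_def by blast
    qed
    moreover have "\<Union> C \<subseteq> V" using C unfolding subset.chain_def by blast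
    ultimately show "\<Union> C \<in> {E. E \<subseteq> V \<and> orthonormal_set E}"
      by (simp add: orthonormal_set_def)
  qed
  then obtain M where M: "M \<subseteq> V" "orthonormal_set M"
    and max: "\<And>X. X \<subseteq> V \<Longrightarrow> orthonormal_set X \<Longrightarrow> M \<subseteq> X \<Longrightarrow> X = M"
    by auto
  have "x = 0" if x: "x \<in> V" "\<forall>e\<in>M. cinner x e = 0" for x
  proof (rule ccontr)
    assume "x \<noteq> 0"
    define u where "u = complex_of_real (1 / norm x) *\<^sub>C x"
    have uu: "cinner u u = 1"
      using \<open>x \<noteq> 0\<close>
      by (simp add: u_def cinner_scaleC_left cinner_scaleC_right cinner_self norm_scaleC norm_divide power2_eq_square)
    have ue: "cinner u e = 0" "cinner e u = 0" if "e \<in> M" for e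
    proof -
      show "cinner u e = 0" using x(2) that by (simp add: u_def cinner_scaleC_left)
      then show "cinner e u = 0" by (subst cinner_commute) simp
    qed
    have "orthonormal_set (insert u M)"
      using M(2) uu ue unfolding orthonormal_set_def by force
    moreover have "insert u M \<subseteq> V"
      using M(1) x(1) complex_vector.subspace_scale[OF assms] by (simp add: u_def)
    ultimately have "u \<in> M" using max[of "insert u M"] by blast
    then show False using uu ue by force
  qed
  then show ?thesis using M by blast
qed

lemma finite_maximal_orthonormal_set_spans:
  fixes V :: "'a :: complex_inner set"
  assumes V: "csubspace V" "E \<subseteq> V" and E: "finite E" "orthonormal_set E"
    and max: "\<And>x. x \<in> V \<Longrightarrow> (\<And>e. e \<in> E \<Longrightarrow> cinner x e = 0) \<Longrightarrow> x = 0"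
  shows "cspan E = V"
proof
  show "cspan E \<subseteq> V" using V by (intro complex_vector.span_minimal)
  show "V \<subseteq> cspan E"
  proof
    fix x assume x: "x \<in> V"
    define p where "p = (\<Sum>e\<in>E. cinner x e *\<^sub>C e)"
    have p: "p \<in> cspan E"
      unfolding p_def
      by (intro complex_vector.span_sum complex_vector.span_scale complex_vector.span_base)
    have "cinner (x - p) f = 0" if f: "f \<in> E" for f
    proof -
      have "cinner p f = (\<Sum>e\<in>E. if e = f then cinner x e else 0)"
        unfolding p_def cinner_sum_left cinner_scaleC_left
        using E(2) f by (intro sum.cong) (auto simp: orthonormal_set_def)
      then show ?thesis using E(1) f by (simp add: cinner_diff_left)
    qed
    moreover have "x - p \<in> V"
      using x p \<open>cspan E \<subseteq> V\<close> complex_vector.subspace_diff[OF V(1)] by blast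
    ultimately have "x - p = 0" using max by blast
    then show "x \<in> cspan E" using p by simp
  qed
qed

section \<open>A skew-adjoint operator without eigenvectors in a given subspace\<close>

lemma parallelogram_bound:
  fixes a b :: "'a :: real_inner"
  shows "(norm (a - b))\<^sup>2 \<le> 2 * (norm a)\<^sup>2 + 2 * (norm b)\<^sup>2"
  using inner_ge_zero[of "a + b"]
  unfolding power2_norm_eq_inner
  by (simp add: inner_diff_left inner_diff_right inner_add_left inner_add_right inner_commute)

context
  fixes e :: "nat \<Rightarrow> 'a :: complex_hilbert_space"
  assumes orthonormal: "\<And>m n. cinner (e m) (e n) = of_bool (m = n)"
begin

lemma cinner_orthonormal_sum:
  assumes "finite A"
  shows "cinner (\<Sum>n\<in>A. c n *\<^sub>C e n) (e k) = (if k \<in> A then c k else 0)"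
proof -
  have "cinner (\<Sum>n\<in>A. c n *\<^sub>C e n) (e k) = (\<Sum>n\<in>A. if n = k then c n else 0)"
    unfolding cinner_sum_left cinner_scaleC_left by (intro sum.cong) (auto simp: orthonormal)
  then show ?thesis using assms by simp
qed

lemma norm_orthonormal_sum:
  assumes "finite A"
  shows "(norm (\<Sum>n\<in>A. c n *\<^sub>C e n))\<^sup>2 = (\<Sum>n\<in>A. (cmod (c n))\<^sup>2)"
proof -
  let ?s = "\<Sum>n\<in>A. c n *\<^sub>C e n"
  have "complex_of_real ((norm ?s)\<^sup>2) = (\<Sum>n\<in>A. c n * cinner (e n) ?s)"
    unfolding cinner_self[symmetric] by (subst cinner_sum_left) (simp add: cinner_scaleC_left)
  also have "\<dots> = (\<Sum>n\<in>A. c n * cnj (c n))"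
  proof (rule sum.cong)
    fix n assume "n \<in> A"
    then have "cinner (e n) ?s = cnj (c n)"
      using assms by (subst cinner_commute) (simp add: cinner_orthonormal_sum)
    then show "c n * cinner (e n) ?s = c n * cnj (c n)" by simp
  qed simp
  also have "\<dots> = complex_of_real (\<Sum>n\<in>A. (cmod (c n))\<^sup>2)"
    by (simp only: of_real_sum complex_norm_square)
  finally show ?thesis by (simp only: of_real_eq_iff)
qed

lemma Bessel_inequality:
  assumes "finite A"
  shows "(\<Sum>n\<in>A. (cmod (cinner x (e n)))\<^sup>2) \<le> (norm x)\<^sup>2"
proof -
  let ?p = "\<Sum>n\<in>A. cinner x (e n) *\<^sub>C e n"
  have "cinner (x - ?p) ?p = cnj (cinner ?p (x - ?p))" by (rule cinner_commute)
  also have "cinner ?p (x - ?p) = (\<Sum>n\<in>A. cinner x (e n) * cnj (cinner (x - ?p) (e n)))"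
    unfolding cinner_sum_left cinner_scaleC_left using cinner_commute by metis
  also have "\<dots> = 0"
    using assms by (simp add: cinner_diff_left cinner_orthonormal_sum)
  finally have orth: "inner (x - ?p) ?p = 0" by (simp add: inner_cinner)
  have "(norm x)\<^sup>2 = (norm ((x - ?p) + ?p))\<^sup>2" by simp
  also have "\<dots> = (norm (x - ?p))\<^sup>2 + (norm ?p)\<^sup>2"
    unfolding power2_norm_eq_inner inner_add_left inner_add_right using orth by (simp add: inner_commute)
  also have "(norm ?p)\<^sup>2 = (\<Sum>n\<in>A. (cmod (cinner x (e n)))\<^sup>2)"
    by (rule norm_orthonormal_sum[OF assms])
  finally show ?thesis by simp
qed

lemma coordinates_tendsto_0: "(\<lambda>n. cinner x (e n)) \<longlonglongrightarrow> 0"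
proof -
  have "summable (\<lambda>n. (cmod (cinner x (e n)))\<^sup>2)"
    by (rule summableI_nonneg_bounded[of _ "(norm x)\<^sup>2"]) (auto intro: Bessel_inequality)
  then have "(\<lambda>n. (cmod (cinner x (e n)))\<^sup>2) \<longlonglongrightarrow> 0" by (rule summable_LIMSEQ_zero)
  then have "(\<lambda>n. sqrt ((cmod (cinner x (e n)))\<^sup>2)) \<longlonglongrightarrow> sqrt 0" by (rule tendsto_real_sqrt)
  then show ?thesis by (simp add: tendsto_norm_zero_iff)
qed

lemma summable_orthonormal_series:
  assumes "summable (\<lambda>n. (cmod (c n))\<^sup>2)"
  shows "summable (\<lambda>n. c n *\<^sub>C e n)"
  unfolding summable_Cauchy
proof (intro allI impI)
  fix r :: real assume "0 < r"
  then obtain N where N: "\<And>m n. N \<le> m \<Longrightarrow> norm (\<Sum>k\<in>{m..<n}. (cmod (c k))\<^sup>2) < r\<^sup>2"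
    using assms unfolding summable_Cauchy by (metis zero_less_power)
  have "norm (\<Sum>k\<in>{m..<n}. c k *\<^sub>C e k) < r" if "N \<le> m" for m n
    using N[OF that, of n] \<open>0 < r\<close> norm_orthonormal_sum[of "{m..<n}" c]
    by (intro power2_less_imp_less[of _ r]) auto
  then show "\<exists>N. \<forall>m\<ge>N. \<forall>n. norm (\<Sum>k\<in>{m..<n}. c k *\<^sub>C e k) < r" by blast
qed

text \<open>
  With \<open>U e\<^sub>n = e\<^sub>n\<^sub>+\<^sub>1\<close>, the coefficients of \<open>(U - U\<^sup>*) x\<close>, where the coordinate of \<open>x\<close> with
  index \<open>-1\<close> is read as \<open>0\<close>. The operator must not be compact: a compact normal operator on a nonzero space
  always has an eigenvector. So weights that decay, which would make the series converge absolutely, cannot be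
  inserted, and convergence comes from orthogonality.
\<close>

definition shift_coeff :: "'a \<Rightarrow> nat \<Rightarrow> complex"
  where "shift_coeff x n = (if n = 0 then 0 else cinner x (e (n - 1))) - cinner x (e (Suc n))"

definition skew_shift :: "'a \<Rightarrow> 'a"
  where "skew_shift x = (\<Sum>n. shift_coeff x n *\<^sub>C e n)"

lemma shift_coeff_square_sum_le: "(\<Sum>n<N. (cmod (shift_coeff x n))\<^sup>2) \<le> 4 * (norm x)\<^sup>2"
proof -
  let ?a = "\<lambda>n. cinner x (e n)"
  have "(\<Sum>n<N. (cmod (shift_coeff x n))\<^sup>2) \<le>
      (\<Sum>n<N. 2 * (if n = 0 then 0 else (cmod (?a (n - 1)))\<^sup>2) + 2 * (cmod (?a (Suc n)))\<^sup>2)"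
    by (intro sum_mono) (auto simp: shift_coeff_def intro: order_trans[OF parallelogram_bound])
  also have "\<dots> = 2 * (\<Sum>n<N. (if n = 0 then 0 else (cmod (?a (n - 1)))\<^sup>2)) + 2 * (\<Sum>n<N. (cmod (?a (Suc n)))\<^sup>2)"
    by (simp add: sum.distrib sum_distrib_left)
  also have "(\<Sum>n<N. (if n = 0 then 0 else (cmod (?a (n - 1)))\<^sup>2)) \<le> (norm x)\<^sup>2"
  proof (cases N)
    case (Suc M)
    show ?thesis
      unfolding Suc by (subst sum.lessThan_Suc_shift) (simp add: Bessel_inequality)
  qed simp
  also have "(\<Sum>n<N. (cmod (?a (Suc n)))\<^sup>2) = (\<Sum>n\<in>Suc ` {..<N}. (cmod (?a n))\<^sup>2)"
    by (simp add: sum.reindex)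
  also have "\<dots> \<le> (norm x)\<^sup>2" by (rule Bessel_inequality) simp
  finally show ?thesis by simp
qed

lemma sums_skew_shift: "(\<lambda>n. shift_coeff x n *\<^sub>C e n) sums skew_shift x"
  unfolding skew_shift_def
  by (intro summable_sums summable_orthonormal_series summableI_nonneg_bounded[of _ "4 * (norm x)\<^sup>2"])
    (auto intro: shift_coeff_square_sum_le)

lemma cinner_skew_shift: "cinner (skew_shift x) (e k) = shift_coeff x k"
proof -
  have "(\<lambda>n. cinner (shift_coeff x n *\<^sub>C e n) (e k)) sums cinner (skew_shift x) (e k)"
    by (rule bounded_linear.sums[OF bounded_linear_cinner_left sums_skew_shift])
  moreover have "(\<lambda>n. cinner (shift_coeff x n *\<^sub>C e n) (e k)) = (\<lambda>n. if n = k then shift_coeff x n else 0)"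
    by (auto simp: cinner_scaleC_left orthonormal)
  ultimately show ?thesis using sums_single sums_unique2 by metis
qed

lemma skew_shift_bounded_clinear: "bounded_clinear skew_shift"
  unfolding bounded_clinear_def
proof (intro conjI allI)
  have scaleC: "skew_shift (c *\<^sub>C x) = c *\<^sub>C skew_shift x" for c x
  proof -
    have coeff: "shift_coeff (c *\<^sub>C x) n = c * shift_coeff x n" for n
      by (simp add: shift_coeff_def cinner_scaleC_left right_diff_distrib)
    have "(\<lambda>n. shift_coeff (c *\<^sub>C x) n *\<^sub>C e n) sums (c *\<^sub>C skew_shift x)"
      using bounded_linear.sums[OF bounded_linear_scaleC_right sums_skew_shift[of x], of c]
      by (simp add: scaleC_scaleC coeff)
    then show ?thesis using sums_skew_shift sums_unique2 by blast
  qed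
  then show "skew_shift (c *\<^sub>C x) = c *\<^sub>C skew_shift x" for c x .
  show "bounded_linear skew_shift"
  proof (rule bounded_linear_intro)
    fix x y
    have "shift_coeff (x + y) n = shift_coeff x n + shift_coeff y n" for n
      by (simp add: shift_coeff_def cinner_add_left)
    then have "(\<lambda>n. shift_coeff (x + y) n *\<^sub>C e n) sums (skew_shift x + skew_shift y)"
      using sums_add[OF sums_skew_shift[of x] sums_skew_shift[of y]] by (simp add: scaleC_add_left)
    then show "skew_shift (x + y) = skew_shift x + skew_shift y"
      using sums_skew_shift sums_unique2 by blast
    show "skew_shift (r *\<^sub>R x) = r *\<^sub>R skew_shift x" for r
      by (simp add: scaleR_scaleC scaleC)
    have lim: "(\<lambda>N. norm (\<Sum>n<N. shift_coeff x n *\<^sub>C e n)) \<longlonglongrightarrow> norm (skew_shift x)"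
      using sums_skew_shift[of x] unfolding sums_def by (rule tendsto_norm)
    have "norm (\<Sum>n<N. shift_coeff x n *\<^sub>C e n) \<le> norm x * 2" for N
    proof (rule power2_le_imp_le)
      show "(norm (\<Sum>n<N. shift_coeff x n *\<^sub>C e n))\<^sup>2 \<le> (norm x * 2)\<^sup>2"
        using shift_coeff_square_sum_le[of x N]
        by (simp add: norm_orthonormal_sum power_mult_distrib mult.commute)
    qed simp
    then show "norm (skew_shift x) \<le> norm x * 2"
      using LIMSEQ_le_const2[OF lim] by blast
  qed
qed

text \<open>
  Expanding both inner products in coordinates, the partial sums of their sum telescope to two
  products of coordinates that tend to \<open>0\<close>.
\<close>

lemma cinner_skew_shift_skew: "cinner (skew_shift x) y = - cinner x (skew_shift y)"
proof -
  let ?a = "\<lambda>n. cinner x (e n)" and ?b = "\<lambda>n. cinner y (e n)"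
  let ?t = "\<lambda>n. shift_coeff x n * cnj (?b n) + ?a n * cnj (shift_coeff y n)"
  have expand: "(\<lambda>n. shift_coeff u n * cnj (cinner v (e n))) sums cinner (skew_shift u) v" for u v
  proof -
    have "cinner (e n) v = cnj (cinner v (e n))" for n by (rule cinner_commute)
    then show ?thesis
      using bounded_linear.sums[OF bounded_linear_cinner_left[of v] sums_skew_shift[of u]]
      by (simp only: cinner_scaleC_left)
  qed
  have "(\<lambda>n. ?a n * cnj (shift_coeff y n)) sums cinner x (skew_shift y)"
    using sums_cnj[THEN iffD2, OF expand[of y x]] cinner_commute[of x "skew_shift y"]
    by (simp add: mult.commute)
  then have "?t sums (cinner (skew_shift x) y + cinner x (skew_shift y))"
    by (rule sums_add[OF expand])
  moreover have "?t sums 0"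
    unfolding sums_def_le
  proof -
    have "(\<Sum>n\<le>N. ?t n) = - (?a (Suc N) * cnj (?b N)) - ?a N * cnj (?b (Suc N))" for N
    proof (induction N)
      case 0
      show ?case by (simp add: shift_coeff_def)
    next
      case (Suc N)
      have "?t (Suc N) = (- (?a (Suc (Suc N)) * cnj (?b (Suc N))) - ?a (Suc N) * cnj (?b (Suc (Suc N))))
          - (- (?a (Suc N) * cnj (?b N)) - ?a N * cnj (?b (Suc N)))"
        by (simp add: shift_coeff_def algebra_simps)
      then show ?case unfolding sum.atMost_Suc Suc by simp
    qed
    moreover have "(\<lambda>N. - (?a (Suc N) * cnj (?b N)) - ?a N * cnj (?b (Suc N))) \<longlonglongrightarrow> - (0 * cnj 0) - 0 * cnj 0"
      by (intro tendsto_intros coordinates_tendsto_0 LIMSEQ_Suc)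
    ultimately show "(\<lambda>N. \<Sum>n\<le>N. ?t n) \<longlonglongrightarrow> 0" by simp
  qed
  ultimately have "cinner (skew_shift x) y + cinner x (skew_shift y) = 0"
    by (rule sums_unique2)
  then show ?thesis by (simp add: eq_neg_iff_add_eq_0)
qed

lemma skew_shift_in_closed_subspace:
  assumes "csubspace V" "closed V" "range e \<subseteq> V"
  shows "skew_shift x \<in> V"
proof (rule closed_sequentially[OF assms(2)])
  show "(\<Sum>n<N. shift_coeff x n *\<^sub>C e n) \<in> V" for N
    using assms by (intro complex_vector.subspace_sum complex_vector.subspace_scale) auto
  show "(\<lambda>N. \<Sum>n<N. shift_coeff x n *\<^sub>C e n) \<longlonglongrightarrow> skew_shift x"
    using sums_skew_shift unfolding sums_def .
qed

text \<open>
  The coordinates of an eigenvector satisfy \<open>a\<^sub>n\<^sub>+\<^sub>2 = a\<^sub>n - \<mu> a\<^sub>n\<^sub>+\<^sub>1\<close>. A quadratic form in two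
  consecutive coordinates only changes sign along this recurrence, while it tends to \<open>0\<close>; at the start it
  is \<open>- a\<^sub>0\<^sup>2\<close>, so \<open>a\<^sub>0\<close>, and with it every coordinate, vanishes.
\<close>

lemma skew_shift_eigenvector_coordinates:
  assumes "skew_shift x = \<mu> *\<^sub>C x"
  shows "cinner x (e n) = 0"
proof -
  let ?a = "\<lambda>n. cinner x (e n)"
  have rec: "shift_coeff x n = \<mu> * ?a n" for n
    using cinner_skew_shift[of x n] by (simp add: assms cinner_scaleC_left)
  have "- ?a (Suc 0) = \<mu> * ?a 0"
    using rec[of 0] by (simp add: shift_coeff_def)
  then have rec0: "?a (Suc 0) = - \<mu> * ?a 0"
    by (metis minus_minus mult_minus_left)
  have rec_Suc: "?a (Suc (Suc n)) = ?a n - \<mu> * ?a (Suc n)" for n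
    using rec[of "Suc n"] by (simp add: shift_coeff_def algebra_simps)
  define Q where "Q = (\<lambda>n. (?a (Suc n))\<^sup>2 + \<mu> * ?a (Suc n) * ?a n - (?a n)\<^sup>2)"
  have "Q (Suc n) = - Q n" for n
    unfolding Q_def rec_Suc by (simp add: power2_eq_square algebra_simps)
  then have "cmod (Q n) = cmod (Q 0)" for n
    by (induction n) simp_all
  moreover have "Q 0 = - (?a 0)\<^sup>2"
    using rec0 by (simp add: Q_def power2_eq_square)
  moreover have "(\<lambda>n. cmod (Q n)) \<longlonglongrightarrow> cmod (0\<^sup>2 + \<mu> * 0 * 0 - 0\<^sup>2)"
    unfolding Q_def by (intro tendsto_intros coordinates_tendsto_0 LIMSEQ_Suc)
  ultimately have a0: "?a 0 = 0" by (simp add: LIMSEQ_const_iff)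
  have "?a n = 0 \<and> ?a (Suc n) = 0"
    by (induction n) (use a0 rec0 rec_Suc in auto)
  then show ?thesis by blast
qed

end

section \<open>The role of the dimension of the kernel\<close>

lemma skew_adjointI:
  assumes "\<And>x y. cinner (J x) y = - cinner x (J y)"
  shows "skew_adjoint J"
  unfolding skew_adjoint_def
  by (rule cadjoint_unique) (simp add: assms cinner_minus_right)

text \<open>
  The shift along a maximal orthonormal set of \<open>V\<close>, which is countable by separability and infinite
  because a finite one would span \<open>V\<close>. The coordinates of an eigenvector in \<open>V\<close> vanish, so by maximality
  the eigenvector would be \<open>0\<close>.
\<close>

lemma infinite_dimensional_counterexample:
  fixes V :: "'a :: complex_hilbert_space set"
  assumes sep: "separable_space (euclidean :: 'a topology)"
    and V: "csubspace V" "closed V" "\<not> cfinite_dimensional V"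
  shows "\<exists>J :: 'a \<Rightarrow> 'a. bounded_clinear J \<and> skew_adjoint J \<and> J ` V \<subseteq> V \<and>
    (\<forall>x\<in>V. \<not> is_eigenvector J x)"
proof -
  obtain E where E: "E \<subseteq> V" "orthonormal_set E"
    and max: "\<And>x. x \<in> V \<Longrightarrow> (\<And>e. e \<in> E \<Longrightarrow> cinner x e = 0) \<Longrightarrow> x = 0"
    using maximal_orthonormal_set_exists[OF V(1)] by blast
  have "infinite E"
    using finite_maximal_orthonormal_set_spans[OF V(1) E(1) _ E(2) max] V(3)
    unfolding cfinite_dimensional_def by blast
  then obtain e :: "nat \<Rightarrow> 'a" where e: "bij_betw e UNIV E"
    using countable_orthonormal_set[OF sep E(2)] bij_betw_from_nat_into by blast
  have on: "cinner (e m) (e n) = of_bool (m = n)" for m n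
    using e E(2) unfolding orthonormal_set_def bij_betw_def by (auto simp: inj_eq)
  have eE: "range e = E" using e by (simp add: bij_betw_def)
  show ?thesis
  proof (intro exI[of _ "skew_shift e"] conjI ballI notI)
    show "bounded_clinear (skew_shift e)" by (rule skew_shift_bounded_clinear[OF on])
    show "skew_adjoint (skew_shift e)"
      by (rule skew_adjointI) (rule cinner_skew_shift_skew[OF on])
    show "skew_shift e ` V \<subseteq> V"
      using skew_shift_in_closed_subspace[OF on V(1,2)] eE E(1) by blast
    fix x assume x: "x \<in> V" "is_eigenvector (skew_shift e) x"
    then obtain \<mu> where "x \<noteq> 0" "skew_shift e x = \<mu> *\<^sub>C x"
      unfolding is_eigenvector_def by blast
    then show False
      using skew_shift_eigenvector_coordinates[OF on] max[OF x(1)] eE by blast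
  qed
qed

theorem proposition2p2:
  fixes R :: "'a :: complex_hilbert_space \<Rightarrow> 'a"
  assumes "separable_space (euclidean :: 'a topology)"
    and "bounded_clinear R" and "self_adjoint R" and "nonneg_op R"
  shows "(\<forall>J :: 'a \<Rightarrow> 'a. bounded_clinear J \<and> skew_adjoint J \<longrightarrow>
            (B1 J R \<longleftrightarrow> B2 J R) \<and> (B2 J R \<longleftrightarrow> B3 J R) \<and> (B3 J R \<longleftrightarrow> B4 J R) \<and> (B4 J R \<longrightarrow> B5 J R))
       \<and> ((\<forall>J :: 'a \<Rightarrow> 'a. bounded_clinear J \<and> skew_adjoint J \<longrightarrow> (B5 J R \<longrightarrow> B4 J R))
            \<longleftrightarrow> cfinite_dimensional (ker R))"
proof (intro conjI)
  show "\<forall>J :: 'a \<Rightarrow> 'a. bounded_clinear J \<and> skew_adjoint J \<longrightarrow>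
      (B1 J R \<longleftrightarrow> B2 J R) \<and> (B2 J R \<longleftrightarrow> B3 J R) \<and> (B3 J R \<longleftrightarrow> B4 J R) \<and> (B4 J R \<longrightarrow> B5 J R)"
    using B1_iff_B2 B2_iff_B3 B2_iff_B4 B4_imp_B5 assms(2-4) by metis
  show "(\<forall>J :: 'a \<Rightarrow> 'a. bounded_clinear J \<and> skew_adjoint J \<longrightarrow> (B5 J R \<longrightarrow> B4 J R)) \<longleftrightarrow>
      cfinite_dimensional (ker R)"
  proof
    assume fin: "cfinite_dimensional (ker R)"
    then obtain B where B: "finite B" "cspan B = ker R"
      unfolding cfinite_dimensional_def by blast
    show "\<forall>J :: 'a \<Rightarrow> 'a. bounded_clinear J \<and> skew_adjoint J \<longrightarrow> (B5 J R \<longrightarrow> B4 J R)"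
      unfolding B4_def
    proof (intro allI impI, rule ccontr)
      fix J :: "'a \<Rightarrow> 'a" and V
      assume J: "bounded_clinear J \<and> skew_adjoint J" and "B5 J R"
        and V: "csubspace V \<and> closed V \<and> V \<subseteq> ker R \<and> J ` V \<subseteq> V" "V \<noteq> {0}"
      have "\<exists>u\<in>V. is_eigenvector J u"
        by (rule finite_dimensional_invariant_eigenvector[OF _ _ _ _ B(1)]) (use J V B(2) in auto)
      then show False using \<open>B5 J R\<close> V(1) unfolding B5_def by blast
    qed
  next
    assume imp: "\<forall>J :: 'a \<Rightarrow> 'a. bounded_clinear J \<and> skew_adjoint J \<longrightarrow> (B5 J R \<longrightarrow> B4 J R)"
    show "cfinite_dimensional (ker R)"
    proof (rule ccontr)
      assume inf: "\<not> cfinite_dimensional (ker R)"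
      note ker = ker_closed_csubspace[OF assms(2)]
      obtain J where J: "bounded_clinear J" "skew_adjoint J" "J ` ker R \<subseteq> ker R"
        and no_eig: "\<forall>x\<in>ker R. \<not> is_eigenvector J x"
        using infinite_dimensional_counterexample[OF assms(1) ker(2,1) inf] by (elim exE conjE)
      \<comment> \<open>\<open>ker R\<close> is itself invariant under \<open>J\<close>, so \<open>B4\<close> would make it trivial\<close>
      have "B5 J R" using no_eig unfolding B5_def by blast
      then have "B4 J R" using imp J by blast
      then have "ker R = {0}" using ker J(3) unfolding B4_def by blast
      then have "cfinite_dimensional (ker R)"
        unfolding cfinite_dimensional_def by (intro exI[of _ "{}"]) simp
      then show False using inf by blast
    qed
  qed
qed

end
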